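(* Consider the belief dynamics on $\mathbb{R}^{N_aN_o}$ given, for $i=1,\dots,N_a$ and $j=1,\dots,N_o$, by $$\dot z_{ij}=-d\,z_{ij}+u\Big(S_1\big(\alpha z_{ij}+\gamma\sum_{k\ne i}(A_a)_{ik}z_{kj}\big)+\sum_{l\neq j}S_2\big(\beta (A_o)_{jl}z_{il}+\delta (A_o)_{jl}\sum_{k\neq i}(A_a)_{ik}z_{kl}\big)\Big),$$ with communication graph $\mathcal G_a$ and belief system graph $\mathcal G_o$ having signed adjacency matrices $A_a$, $A_o$. (a) Suppose there exists a switching matrix $M$ such that $MA_aM$ is eventually positive, and suppose the leading eigenvalues of $A_o$ are a complex-conjugate pair with positive real part. Then there exists a critical value $\gamma^*$ such that whenever $\gamma>\gamma^*$, the indecision-breaking bifurcation of the origin at $u=u^*$ is a Hopf bifurcation. (b) Suppose there exists a switching matrix $M$ such that $MA_oM$ is eventually positive, and suppose the leading eigenvalues of $A_a$ are a complex-conjugate pair with positive real part. Then there exists a critical value $\beta^*$ such that whenever $\beta>\beta^*$, the indecision-breaking bifurcation of the origin at $u=u^*$ is a Hopf bifurcation. Here $u^*=d/K$ with $K=\max_{\lambda\in\sigma(A_a),\,\mu\in\sigma(A_o)}\operatorname{Re}(\alpha+\gamma\lambda+\beta\mu+\delta\lambda\mu)$, and "the bifurcation at $u=u^*$ is a Hopf bifurcation" means that $K>0$ and $(\boldsymbol Z,u)=(\mathbf 0,u^* )$ is a Hopf bifurcation point.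
   Context: $N_a,N_o$ are positive integers. The state is $\boldsymbol Z=(z_{ij})\in\mathbb{R}^{N_aN_o}$. $A_a\in\mathbb{R}^{N_a\times N_a}$ and $A_o\in\mathbb{R}^{N_o\times N_o}$ are signed unweighted adjacency matrices of simple directed graphs: entries in $\{0,1,-1\}$, zero diagonal. Parameters: $d>0$, $u\ge0$, gains $\alpha,\gamma,\beta,\delta\ge0$; in (a) the threshold $\gamma^*$ may depend on the graphs and the remaining gains, and in (b) likewise $\beta^*$. $S_1,S_2:\mathbb{R}\to\mathbb{R}$ are bounded, odd, with $S_r(0)=0$, $S_r'(0)=1$, $S_r''(0)=0$, $S_r'''(0)\ne0$ for $r=1,2$. The Jacobian at the equilibrium $\boldsymbol Z=\mathbf 0$ is $$J(\mathbf 0,u)=(-d+u\alpha)\,I_{N_a}\otimes I_{N_o}+u\gamma\,A_a\otimes I_{N_o}+u\beta\,I_{N_a}\otimes A_o+u\delta\,A_a\otimes A_o .$$ When $K>0$, the origin is locally exponentially stable for $u<u^*$ and unstable for $u>u^*$; this loss of stability is called the indecision-breaking bifurcation. An eigenvalue $\lambda$ of a matrix $A$ is leading if $\operatorname{Re}\lambda\ge\operatorname{Re}\mu$ for all $\mu\in\sigma(A)$; "the leading eigenvalues are a complex-conjugate pair" means that, counted with multiplicity, they are exactly two non-real conjugate numbers. A switching matrix is a diagonal matrix with diagonal entries in $\{1,-1\}$. A real square matrix $A$ is eventually positive if there is a positive integer $k_0$ such that all entries of $A^k$ are strictly positive for all integers $k>k_0$. Hopf bifurcation point: the equilibrium $\mathbf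 0$ at $u=u^*$ is a Hopf bifurcation point if (i) $J(\mathbf 0,u^* )$ has a complex-conjugate pair of eigenvalues $\pm i\omega_0$, $\omega_0\neq0$; (ii) no other eigenvalues of $J(\mathbf 0,u^* )$ (counted with multiplicity) lie on the imaginary axis; (iii) if $r(u)\pm i\omega(u)$ are the eigenvalues of $J(\mathbf 0,u)$ smoothly parametrized by $u$ with $r(u^* )=0$, $\omega(u^* )=\omega_0$, then $r'(u^* )\neq0$.
   Formalization: Part (a) additionally assumes that β>0 or δ>0, and part (b) that γ>0 or δ>0; without this one graph drops out of the Jacobian, whose leading eigenvalue is then real, so the Hopf claim fails. *)

theory Defs
  imports Complex_Main "Jordan_Normal_Form.Spectral_Radius"
begin

definition signed_adjacency_mat :: "nat \<Rightarrow> real mat \<Rightarrow> bool" where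
  "signed_adjacency_mat n A \<longleftrightarrow> A \<in> carrier_mat n n
     \<and> (\<forall>i<n. \<forall>j<n. A $$ (i, j) \<in> {0, 1, -1}) \<and> (\<forall>i<n. A $$ (i, i) = 0)"

definition switching_mat :: "nat \<Rightarrow> real mat \<Rightarrow> bool" where
  "switching_mat n M \<longleftrightarrow> M \<in> carrier_mat n n \<and> diagonal_mat M \<and> (\<forall>i<n. M $$ (i, i) \<in> {1, -1})"

definition eventually_positive :: "nat \<Rightarrow> real mat \<Rightarrow> bool" where
  "eventually_positive n A \<longleftrightarrow> A \<in> carrier_mat n n
     \<and> (\<exists>k0>0. \<forall>k>k0. \<forall>i<n. \<forall>j<n. (A ^\<^sub>m k) $$ (i, j) > 0)"

abbreviation cmat :: "real mat \<Rightarrow> complex mat" where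
  "cmat \<equiv> map_mat complex_of_real"

text \<open>Eigenvalues with algebraic multiplicity.\<close>

definition eigenvalue_mset :: "complex mat \<Rightarrow> complex multiset" where
  "eigenvalue_mset A = proots (char_poly A)"

definition leading :: "complex mat \<Rightarrow> complex \<Rightarrow> bool" where
  "leading A l \<longleftrightarrow> l \<in> spectrum A \<and> (\<forall>m \<in> spectrum A. Re m \<le> Re l)"

definition leading_pair_pos :: "real mat \<Rightarrow> bool" where
  "leading_pair_pos A \<longleftrightarrow> (\<exists>m. Im m \<noteq> 0 \<and> Re m > 0 \<and>
     filter_mset (leading (cmat A)) (eigenvalue_mset (cmat A)) = {#m, cnj m#})"

text \<open>Only the derivatives of orders one to three at the origin are assumed to exist.\<close>

definition saturating :: "(real \<Rightarrow> real) \<Rightarrow> bool" where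
  "saturating S \<longleftrightarrow> (\<exists>B. \<forall>x. \<bar>S x\<bar> \<le> B) \<and> (\<forall>x. S (- x) = - S x) \<and> S 0 = 0 \<and>
     (\<exists>S1 S2 c. (\<forall>\<^sub>F x in nhds 0. (S has_real_derivative S1 x) (at x)) \<and>
                (\<forall>\<^sub>F x in nhds 0. (S1 has_real_derivative S2 x) (at x)) \<and>
                (S2 has_real_derivative c) (at 0) \<and>
                S1 0 = 1 \<and> S2 0 = 0 \<and> c \<noteq> 0)"

text \<open>
  The state entry with agent index \<open>i < Na\<close> and option index \<open>j < No\<close> is stored at position
  \<open>i * No + j\<close> of a vector of dimension \<open>Na * No\<close>, the ordering for which the Kronecker
  product of an agent matrix and an option matrix acts on the state.
\<close>

definition belief_field ::
  "nat \<Rightarrow> nat \<Rightarrow> real mat \<Rightarrow> real mat \<Rightarrow> (real \<Rightarrow> real) \<Rightarrow> (real \<Rightarrow> real)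
    \<Rightarrow> real \<Rightarrow> real \<Rightarrow> real \<Rightarrow> real \<Rightarrow> real \<Rightarrow> real \<Rightarrow> real vec \<Rightarrow> real vec" where
  "belief_field Na No Aa Ao S1 S2 d \<alpha> \<gamma> \<beta> \<delta> u z = vec (Na * No) (\<lambda>p.
     let i = p div No; j = p mod No; Z = (\<lambda>k l. z $ (k * No + l)) in
       - d * Z i j
       + u * (S1 (\<alpha> * Z i j + \<gamma> * (\<Sum>k \<in> {..<Na} - {i}. Aa $$ (i, k) * Z k j))
            + (\<Sum>l \<in> {..<No} - {j}.
                S2 (\<beta> * Ao $$ (j, l) * Z i l
                    + \<delta> * Ao $$ (j, l) * (\<Sum>k \<in> {..<Na} - {i}. Aa $$ (i, k) * Z k l)))))"

definition has_jacobian :: "nat \<Rightarrow> (real vec \<Rightarrow> real vec) \<Rightarrow> real vec \<Rightarrow> real mat \<Rightarrow> bool" where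
  "has_jacobian n F z J \<longleftrightarrow> J \<in> carrier_mat n n \<and> (\<forall>p<n. \<forall>q<n.
     ((\<lambda>t. F (z + t \<cdot>\<^sub>v unit_vec n q) $ p) has_real_derivative J $$ (p, q)) (at 0))"

definition smooth_near :: "(real \<Rightarrow> real) \<Rightarrow> real \<Rightarrow> bool" where
  "smooth_near f x \<longleftrightarrow> (\<exists>\<epsilon>>0. \<exists>D :: nat \<Rightarrow> real \<Rightarrow> real. D 0 = f \<and>
     (\<forall>k t. \<bar>t - x\<bar> < \<epsilon> \<longrightarrow> (D k has_real_derivative D (Suc k) t) (at t)))"

definition eigenvalue_branch ::
  "(real \<Rightarrow> real mat) \<Rightarrow> real \<Rightarrow> real \<Rightarrow> (real \<Rightarrow> real) \<Rightarrow> (real \<Rightarrow> real) \<Rightarrow> bool" where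
  "eigenvalue_branch J us \<omega>0 r \<omega> \<longleftrightarrow> smooth_near r us \<and> smooth_near \<omega> us \<and> r us = 0 \<and> \<omega> us = \<omega>0 \<and>
     (\<forall>\<^sub>F u in nhds us. eigenvalue (cmat (J u)) (Complex (r u) (\<omega> u)) \<and>
                       eigenvalue (cmat (J u)) (Complex (r u) (- \<omega> u)))"

text \<open>
  The multiset equation says both that \<open>\<plusminus>\<i>\<omega>0\<close> are eigenvalues and that, counted with multiplicity,
  no others lie on the imaginary axis.  Transversality is required of every smooth branch through
  \<open>\<i>\<omega>0\<close>; existence of a branch is required too, so that this condition is never vacuous.
\<close>

definition hopf_bifurcation_point ::
  "nat \<Rightarrow> (real \<Rightarrow> real vec \<Rightarrow> real vec) \<Rightarrow> real vec \<Rightarrow> real \<Rightarrow> bool" where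
  "hopf_bifurcation_point n F z us \<longleftrightarrow> (\<forall>u. F u z = 0\<^sub>v n) \<and>
     (\<exists>J. (\<forall>u. has_jacobian n (F u) z (J u)) \<and>
       (\<exists>\<omega>0. \<omega>0 \<noteq> 0 \<and>
         filter_mset (\<lambda>l. Re l = 0) (eigenvalue_mset (cmat (J us)))
           = {#Complex 0 \<omega>0, Complex 0 (- \<omega>0)#} \<and>
         (\<exists>r \<omega>. eigenvalue_branch J us \<omega>0 r \<omega>) \<and>
         (\<forall>r \<omega>. eigenvalue_branch J us \<omega>0 r \<omega> \<longrightarrow>
            (\<exists>r'. (r has_real_derivative r') (at us) \<and> r' \<noteq> 0))))"

definition max_gain ::
  "real mat \<Rightarrow> real mat \<Rightarrow> real \<Rightarrow> real \<Rightarrow> real \<Rightarrow> real \<Rightarrow> real" where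
  "max_gain Aa Ao \<alpha> \<gamma> \<beta> \<delta> =
     Max ((\<lambda>(l, m). Re (of_real \<alpha> + of_real \<gamma> * l + of_real \<beta> * m + of_real \<delta> * l * m))
            ` (spectrum (cmat Aa) \<times> spectrum (cmat Ao)))"

definition indecision_breaking_hopf ::
  "nat \<Rightarrow> nat \<Rightarrow> real mat \<Rightarrow> real mat \<Rightarrow> (real \<Rightarrow> real) \<Rightarrow> (real \<Rightarrow> real)
    \<Rightarrow> real \<Rightarrow> real \<Rightarrow> real \<Rightarrow> real \<Rightarrow> real \<Rightarrow> bool" where
  "indecision_breaking_hopf Na No Aa Ao S1 S2 d \<alpha> \<gamma> \<beta> \<delta> \<longleftrightarrow>
     max_gain Aa Ao \<alpha> \<gamma> \<beta> \<delta> > 0 \<and>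
     hopf_bifurcation_point (Na * No) (belief_field Na No Aa Ao S1 S2 d \<alpha> \<gamma> \<beta> \<delta>)
       (0\<^sub>v (Na * No)) (d / max_gain Aa Ao \<alpha> \<gamma> \<beta> \<delta>)"

text \<open>
  The Jacobian at the origin, obtained above by differentiating the vector field, is the expected
  combination of Kronecker products.
\<close>

definition kronecker :: "real mat \<Rightarrow> real mat \<Rightarrow> real mat" where
  "kronecker A B = mat (dim_row A * dim_row B) (dim_col A * dim_col B)
     (\<lambda>(p, q). A $$ (p div dim_row B, q div dim_col B) * B $$ (p mod dim_row B, q mod dim_col B))"

lemma saturating_deriv_0:
  assumes "saturating S"
  shows "(S has_real_derivative 1) (at 0)"
proof -
  obtain S1 where "\<forall>\<^sub>F x in nhds 0. (S has_real_derivative S1 x) (at x)" "S1 0 = 1"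
    using assms unfolding saturating_def by blast
  thus ?thesis by (metis eventually_nhds_x_imp_x)
qed

lemma saturating_linear_deriv:
  assumes "saturating S"
  shows "((\<lambda>t. S (t * c)) has_real_derivative c) (at 0)"
proof -
  have "((\<lambda>t. t * c) has_real_derivative c) (at 0)"
    by (auto intro!: derivative_eq_intros)
  moreover have "(S has_real_derivative 1) (at (0 * c))"
    using saturating_deriv_0[OF assms] by simp
  ultimately show ?thesis
    using DERIV_chain2[of S 1 "\<lambda>t. t * c" 0 c UNIV] by simp
qed

lemma index_eq_iff:
  fixes k l q No :: nat
  assumes "l < No"
  shows "k * No + l = q \<longleftrightarrow> k = q div No \<and> l = q mod No"
  using assms by auto

lemma belief_field_jacobian:
  assumes "signed_adjacency_mat Na Aa" "signed_adjacency_mat No Ao" "saturating S1" "saturating S2"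
  shows "has_jacobian (Na * No) (belief_field Na No Aa Ao S1 S2 d \<alpha> \<gamma> \<beta> \<delta> u) (0\<^sub>v (Na * No))
    ((- d + u * \<alpha>) \<cdot>\<^sub>m kronecker (1\<^sub>m Na) (1\<^sub>m No) + (u * \<gamma>) \<cdot>\<^sub>m kronecker Aa (1\<^sub>m No)
      + (u * \<beta>) \<cdot>\<^sub>m kronecker (1\<^sub>m Na) Ao + (u * \<delta>) \<cdot>\<^sub>m kronecker Aa Ao)"
    (is "has_jacobian ?n ?F _ ?J")
proof -
  have dims: "dim_row Aa = Na" "dim_col Aa = Na" "dim_row Ao = No" "dim_col Ao = No"
    and diag: "\<And>i. i < Na \<Longrightarrow> Aa $$ (i, i) = 0" "\<And>j. j < No \<Longrightarrow> Ao $$ (j, j) = 0"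
    using assms(1,2) unfolding signed_adjacency_mat_def by auto
  have "((\<lambda>t. ?F (0\<^sub>v ?n + t \<cdot>\<^sub>v unit_vec ?n q) $ p) has_real_derivative ?J $$ (p, q)) (at 0)"
    if p: "p < ?n" and q: "q < ?n" for p q
  proof -
    define i j a b where ij: "i = p div No" "j = p mod No" and ab: "a = q div No" "b = q mod No"
    have No: "No > 0" using p by (cases No) auto
    have lt: "i < Na" "j < No" "a < Na" "b < No"
      using p q No by (auto simp: ij ab less_mult_imp_div_less)
    define e where "e k l = (if k = a \<and> l = b then 1 else 0 :: real)" for k l
    define y where "y t = 0\<^sub>v ?n + t \<cdot>\<^sub>v unit_vec ?n q" for t :: real
    have Z: "y t $ (k * No + l) = t * e k l"
      if "k < Na" "l < No" for k l t
    proof -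
      have "k * No + l < ?n"
      proof -
        have "k * No + l < (k + 1) * No" using that by simp
        also have "\<dots> \<le> ?n" using that by (intro mult_right_mono) auto
        finally show ?thesis .
      qed
      thus ?thesis using q index_eq_iff[OF that(2), of k q] by (auto simp: e_def ab y_def)
    qed
    have pij: "p = i * No + j" by (simp add: ij)
    have sumA: "(\<Sum>k \<in> {..<Na} - {i}. Aa $$ (i, k) * e k l) = (if l = b then Aa $$ (i, a) else 0)" for l
    proof -
      have "(\<Sum>k \<in> {..<Na} - {i}. Aa $$ (i, k) * e k l) = (\<Sum>k<Na. Aa $$ (i, k) * e k l)"
        using diag(1) lt by (intro sum.mono_neutral_left) auto
      also have "\<dots> = (\<Sum>k<Na. if k = a then (if l = b then Aa $$ (i, a) else 0) else 0)"
        by (intro sum.cong) (auto simp: e_def)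
      finally show ?thesis using lt by simp
    qed
    have sumO: "(\<Sum>l \<in> {..<No} - {j}. \<beta> * Ao $$ (j, l) * e i l
          + \<delta> * Ao $$ (j, l) * (if l = b then Aa $$ (i, a) else 0))
        = \<beta> * (if i = a then Ao $$ (j, b) else 0) + \<delta> * Ao $$ (j, b) * Aa $$ (i, a)"
    proof -
      have "(\<Sum>l \<in> {..<No} - {j}. \<beta> * Ao $$ (j, l) * e i l
          + \<delta> * Ao $$ (j, l) * (if l = b then Aa $$ (i, a) else 0))
        = (\<Sum>l<No. \<beta> * Ao $$ (j, l) * e i l
          + \<delta> * Ao $$ (j, l) * (if l = b then Aa $$ (i, a) else 0))"
        using diag(2) lt by (intro sum.mono_neutral_left) auto
      also have "\<dots> = (\<Sum>l<No. if l = b then \<beta> * (if i = a then Ao $$ (j, b) else 0)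
          + \<delta> * Ao $$ (j, b) * Aa $$ (i, a) else 0)"
        by (intro sum.cong) (auto simp: e_def)
      finally show ?thesis using lt by simp
    qed
    let ?c1 = "\<alpha> * e i j + \<gamma> * (if j = b then Aa $$ (i, a) else 0)"
    let ?c2 = "\<lambda>l. \<beta> * Ao $$ (j, l) * e i l
                    + \<delta> * Ao $$ (j, l) * (if l = b then Aa $$ (i, a) else 0)"
    have in_sum: "(\<Sum>k \<in> {..<Na} - {i}.
        Aa $$ (i, k) * y t $ (k * No + l))
        = t * (if l = b then Aa $$ (i, a) else 0)" if "l < No" for l t
    proof -
      have "(\<Sum>k \<in> {..<Na} - {i}. Aa $$ (i, k) * y t $ (k * No + l))
        = (\<Sum>k \<in> {..<Na} - {i}. t * (Aa $$ (i, k) * e k l))"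
        using that by (intro sum.cong refl) (simp add: Z)
      thus ?thesis by (simp add: sumA flip: sum_distrib_left)
    qed
    have F: "?F (y t) $ p
        = - d * (t * e i j) + u * (S1 (t * ?c1) + (\<Sum>l \<in> {..<No} - {j}. S2 (t * ?c2 l)))" for t
    proof -
      have "?F (y t) $ p
        = - d * (t * e i j) + u * (S1 (\<alpha> * (t * e i j) + \<gamma> * (t * (if j = b then Aa $$ (i, a) else 0)))
          + (\<Sum>l \<in> {..<No} - {j}. S2 (\<beta> * Ao $$ (j, l) * (t * e i l)
                    + \<delta> * Ao $$ (j, l) * (t * (if l = b then Aa $$ (i, a) else 0)))))"
        unfolding belief_field_def Let_def index_vec[OF p] ij(1)[symmetric] ij(2)[symmetric]
          Z[OF lt(1,2)] in_sum[OF lt(2)]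
        by (intro arg_cong2[of _ _ _ _ "(+)"] arg_cong2[of _ _ _ _ "(*)"] refl sum.cong
            arg_cong[of _ _ S2])
           (simp_all add: Z[OF lt(1)] in_sum)
      also have "\<dots> = - d * (t * e i j) + u * (S1 (t * ?c1) + (\<Sum>l \<in> {..<No} - {j}. S2 (t * ?c2 l)))"
        by (intro arg_cong2[of _ _ _ _ "(+)"] arg_cong2[of _ _ _ _ "(*)"] refl sum.cong
            arg_cong[of _ _ S2] arg_cong[of _ _ S1]) (simp_all add: algebra_simps)
      finally show ?thesis .
    qed
    have "((\<lambda>t. - d * (t * e i j) + u * (S1 (t * ?c1) + (\<Sum>l \<in> {..<No} - {j}. S2 (t * ?c2 l))))
        has_real_derivative - d * (1 * e i j) + u * (?c1 + (\<Sum>l \<in> {..<No} - {j}. ?c2 l))) (at 0)"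
      by (intro DERIV_add DERIV_cmult DERIV_sum DERIV_cmult_right DERIV_ident
          saturating_linear_deriv assms)
    moreover have "- d * (1 * e i j) + u * (?c1 + (\<Sum>l \<in> {..<No} - {j}. ?c2 l)) = ?J $$ (p, q)"
      unfolding sumO using p q lt
      by (auto simp: kronecker_def dims e_def algebra_simps simp flip: ij ab)
    ultimately show ?thesis unfolding F[unfolded y_def] by simp
  qed
  thus ?thesis
    unfolding has_jacobian_def by (auto simp: kronecker_def dims)
qed

end

(*
  The eigenvalues of the Jacobian are -d + u g(l, m), where g(l, m) is the bilinear gain of an
  eigenvalue l of Aa and an eigenvalue m of Ao.  By Perron-Frobenius, the matrix that is eventually
  positive after switching has a simple real eigenvalue rho > 0 exceeding all other real parts.
  With a large coefficient on that matrix, the gains of maximal real part K are therefore exactly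
  g(rho, m) and its conjugate, where m and its conjugate are the leading pair of the other matrix.
  The eigenvalue lines -d + u g are affine in u, hence the crossing at u = d/K has speed K > 0.
*)
theory Submission
  imports Defs
begin

subsection \<open>Eigenvalues of bilinear Kronecker combinations\<close>

text \<open>Multiplicity is the obstacle. The Hopf condition counts eigenvalues algebraically, and
  neither adjacency matrix need be diagonalizable, so products of eigenvectors would not suffice.
  Both matrices are therefore triangularized, and spectra are handled as multisets throughout. For
  the same reason the Perron root must be a simple root of the characteristic polynomial, not just
  have a one-dimensional eigenspace; a left Perron vector rules out Jordan blocks. The matrix itself
  may have negative entries, so every positivity argument is run on a high power and then brought
  back to exponent one by comparing two consecutive powers. On the Perron root \<rho> the gain is an
  affine function of the other eigenvalue with slope \<beta> + \<delta> \<rho> (in the second part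
  \<gamma> + \<delta> \<rho>). The condition that one of these two parameters is positive makes the
  slope positive; with both zero all these gains collapse to one real number and no complex pair
  crosses.\<close>

text \<open>A polymorphic twin of \<open>kronecker\<close>, which is fixed to real entries:
  triangularization takes place over the complex numbers.\<close>

definition kron :: "'a :: semiring_1 mat \<Rightarrow> 'a mat \<Rightarrow> 'a mat" where
  "kron A B = mat (dim_row A * dim_row B) (dim_col A * dim_col B)
     (\<lambda>(p, q). A $$ (p div dim_row B, q div dim_col B) * B $$ (p mod dim_row B, q mod dim_col B))"

text \<open>This is the polynomial \<open>c0 + c1 x + c2 y + c3 x y\<close> evaluated at the
  commuting matrices \<open>kron A 1\<close> and \<open>kron 1 B\<close>.\<close>

definition kron_comb ::
  "'a \<Rightarrow> 'a \<Rightarrow> 'a \<Rightarrow> 'a \<Rightarrow> nat \<Rightarrow> nat \<Rightarrow> 'a mat \<Rightarrow> 'a mat \<Rightarrow> 'a :: semiring_1 mat" where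
  "kron_comb c0 c1 c2 c3 na nb A B = c0 \<cdot>\<^sub>m kron (1\<^sub>m na) (1\<^sub>m nb) + c1 \<cdot>\<^sub>m kron A (1\<^sub>m nb)
     + c2 \<cdot>\<^sub>m kron (1\<^sub>m na) B + c3 \<cdot>\<^sub>m kron A B"

lemma kron_carrier:
  "A \<in> carrier_mat ra ca \<Longrightarrow> B \<in> carrier_mat rb cb \<Longrightarrow> kron A B \<in> carrier_mat (ra * rb) (ca * cb)"
  by (auto simp: kron_def)

lemma kron_comb_carrier:
  "A \<in> carrier_mat na na \<Longrightarrow> B \<in> carrier_mat nb nb
    \<Longrightarrow> kron_comb c0 c1 c2 c3 na nb A B \<in> carrier_mat (na * nb) (na * nb)"
  unfolding kron_comb_def by (intro add_carrier_mat smult_carrier_mat kron_carrier) auto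

lemma div_mod_less:
  assumes "(p :: nat) < a * b" shows "p div b < a" "p mod b < b"
proof -
  have "b > 0" using assms by (cases b) auto
  then show "p div b < a" "p mod b < b" using assms by (auto simp: less_mult_imp_div_less)
qed

lemma index_less:
  assumes "(i :: nat) < a" "j < b" shows "i * b + j < a * b"
proof -
  have "i * b + j < Suc i * b" using assms by simp
  also have "\<dots> \<le> a * b" using assms by (intro mult_right_mono) auto
  finally show ?thesis .
qed

lemma index_kron:
  assumes "A \<in> carrier_mat ra ca" "B \<in> carrier_mat rb cb" "p < ra * rb" "q < ca * cb"
  shows "kron A B $$ (p, q) = A $$ (p div rb, q div cb) * B $$ (p mod rb, q mod cb)"
  using assms by (auto simp: kron_def)

lemma sum_div_mod:
  fixes h :: "nat \<Rightarrow> nat \<Rightarrow> 'a :: comm_monoid_add"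
  shows "(\<Sum>p<a * b. h (p div b) (p mod b)) = (\<Sum>i<a. \<Sum>j<b. h i j)"
proof -
  have "(\<Sum>p<a * b. h (p div b) (p mod b)) = (\<Sum>(i, j)\<in>{..<a} \<times> {..<b}. h i j)"
    by (rule sum.reindex_bij_witness[of _ "\<lambda>(i, j). i * b + j" "\<lambda>p. (p div b, p mod b)"])
      (auto simp: div_mod_less intro: index_less)
  then show ?thesis by (simp add: sum.cartesian_product)
qed

lemma mset_div_mod:
  "mset (map (\<lambda>p. h (p div b) (p mod b)) [0..<a * b])
    = (\<Sum>i\<in>#mset [0..<a]. image_mset (h i) (mset [0..<b]))"
proof (induction a)
  case (Suc a)
  have "[0..<Suc a * b] = [0..<a * b] @ [a * b..<a * b + b]"
    using upt_add_eq_append[of 0 "a * b" b] by (simp add: add.commute)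
  moreover have "[a * b..<a * b + b] = map (\<lambda>j. a * b + j) [0..<b]"
    using map_add_upt[of "a * b" b] by (simp add: add.commute)
  moreover have "map (\<lambda>p. h (p div b) (p mod b)) (map (\<lambda>j. a * b + j) [0..<b]) = map (h a) [0..<b]"
    by auto
  ultimately have "map (\<lambda>p. h (p div b) (p mod b)) [0..<Suc a * b]
    = map (\<lambda>p. h (p div b) (p mod b)) [0..<a * b] @ map (h a) [0..<b]"
    by (simp only: map_append)
  then have "mset (map (\<lambda>p. h (p div b) (p mod b)) [0..<Suc a * b])
    = mset (map (\<lambda>p. h (p div b) (p mod b)) [0..<a * b]) + image_mset (h a) (mset [0..<b])"
    by (simp only: mset_append mset_map)
  with Suc show ?case by (simp del: mult_Suc mset_map)
qed simp

lemma index_mult_mat_sum: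
  assumes "A \<in> carrier_mat n m" "B \<in> carrier_mat m l" "i < n" "j < l"
  shows "(A * B) $$ (i, j) = (\<Sum>k<m. A $$ (i, k) * B $$ (k, j))"
  using assms by (auto simp: scalar_prod_def atLeast0LessThan intro!: sum.cong)

text \<open>The mixed-product rule: the summation index splits into quotient and remainder, and the
  resulting double sum factors.\<close>

lemma kron_mult:
  fixes A B C D :: "'a :: comm_semiring_1 mat"
  assumes A: "A \<in> carrier_mat na na" and B: "B \<in> carrier_mat nb nb"
    and C: "C \<in> carrier_mat na na" and D: "D \<in> carrier_mat nb nb"
  shows "kron A B * kron C D = kron (A * C) (B * D)"
proof (rule eq_matI)
  note cs = kron_carrier[OF A B] kron_carrier[OF C D]
    kron_carrier[OF mult_carrier_mat[OF A C] mult_carrier_mat[OF B D]]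
  show "dim_row (kron A B * kron C D) = dim_row (kron (A * C) (B * D))"
    "dim_col (kron A B * kron C D) = dim_col (kron (A * C) (B * D))"
    using cs by auto
  fix p q assume "p < dim_row (kron (A * C) (B * D))" "q < dim_col (kron (A * C) (B * D))"
  hence pq: "p < na * nb" "q < na * nb" using cs by auto
  have "(kron A B * kron C D) $$ (p, q)
      = (\<Sum>k<na * nb. kron A B $$ (p, k) * kron C D $$ (k, q))"
    by (rule index_mult_mat_sum[OF cs(1,2) pq])
  also have "\<dots> = (\<Sum>k<na * nb. (A $$ (p div nb, k div nb) * C $$ (k div nb, q div nb))
      * (B $$ (p mod nb, k mod nb) * D $$ (k mod nb, q mod nb)))"
    using pq by (intro sum.cong) (simp_all add: index_kron[OF A B] index_kron[OF C D] ac_simps)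
  also have "\<dots> = (\<Sum>i<na. A $$ (p div nb, i) * C $$ (i, q div nb))
      * (\<Sum>j<nb. B $$ (p mod nb, j) * D $$ (j, q mod nb))"
    by (subst sum_div_mod) (simp add: sum_product)
  also have "\<dots> = kron (A * C) (B * D) $$ (p, q)"
    using pq div_mod_less[OF pq(1)] div_mod_less[OF pq(2)]
    by (simp add: index_kron[OF mult_carrier_mat[OF A C] mult_carrier_mat[OF B D]]
        index_mult_mat_sum[OF A C] index_mult_mat_sum[OF B D] del: index_mult_mat(1))
  finally show "(kron A B * kron C D) $$ (p, q) = kron (A * C) (B * D) $$ (p, q)" .
qed

lemma kron_one: "kron (1\<^sub>m na) (1\<^sub>m nb) = (1\<^sub>m (na * nb) :: 'a :: semiring_1 mat)"
proof (rule eq_matI)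
  fix p q assume "p < dim_row (1\<^sub>m (na * nb) :: 'a mat)" "q < dim_col (1\<^sub>m (na * nb) :: 'a mat)"
  hence pq: "p < na * nb" "q < na * nb" by auto
  have "p div nb = q div nb \<and> p mod nb = q mod nb \<longleftrightarrow> p = q"
    by (metis div_mult_mod_eq)
  then show "kron (1\<^sub>m na) (1\<^sub>m nb) $$ (p, q) = (1\<^sub>m (na * nb) :: 'a mat) $$ (p, q)"
    using pq div_mod_less[OF pq(1)] div_mod_less[OF pq(2)]
    by (auto simp: index_kron[OF one_carrier_mat one_carrier_mat])
qed (auto simp: kron_def)

lemma index_kron_comb:
  assumes A: "A \<in> carrier_mat na na" and B: "B \<in> carrier_mat nb nb" and pq: "p < na * nb" "q < na * nb"
  shows "kron_comb c0 c1 c2 c3 na nb A B $$ (p, q) =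
      (let i = p div nb; k = q div nb; j = p mod nb; l = q mod nb; e = (\<lambda>x y. if x = y then 1 else 0) in
       c0 * (e i k * e j l) + c1 * (A $$ (i, k) * e j l) + c2 * (e i k * B $$ (j, l))
         + c3 * (A $$ (i, k) * B $$ (j, l)))"
proof -
  have d: "dim_row (kron C D) = na * nb" "dim_col (kron C D) = na * nb"
    if "C \<in> carrier_mat na na" "D \<in> carrier_mat nb nb" for C D :: "'a mat"
    using kron_carrier[OF that] by auto
  show ?thesis
    using pq div_mod_less[OF pq(1)] div_mod_less[OF pq(2)] assms
    by (simp add: kron_comb_def d Let_def index_kron[of _ na na _ nb nb])
qed

text \<open>Conjugation by \<open>kron P Q\<close> is linear and, by the mixed-product rule,
  conjugates each Kronecker factor separately. Identity factors are unchanged, so one conjugation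
  treats all four terms at once.\<close>

lemma kron_comb_similar:
  fixes A B :: "'a :: comm_ring_1 mat"
  assumes A: "similar_mat_wit A A' P P'" and B: "similar_mat_wit B B' Q Q'"
    and Ac: "A \<in> carrier_mat na na" and Bc: "B \<in> carrier_mat nb nb"
  shows "similar_mat (kron_comb c0 c1 c2 c3 na nb A B) (kron_comb c0 c1 c2 c3 na nb A' B')"
proof -
  note a = similar_mat_witD2[OF Ac A] and b = similar_mat_witD2[OF Bc B]
  let ?n = "na * nb" and ?R = "kron P Q" and ?R' = "kron P' Q'"
  have R: "?R \<in> carrier_mat ?n ?n" "?R' \<in> carrier_mat ?n ?n"
    using a b by (auto intro: kron_carrier)
  have conj: "kron (P * C * P') (Q * D * Q') = ?R * kron C D * ?R'"
    if "C \<in> carrier_mat na na" "D \<in> carrier_mat nb nb" for C D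
    using that a b by (simp add: kron_mult[of _ na _ nb])
  have 1: "P * 1\<^sub>m na * P' = 1\<^sub>m na" "Q * 1\<^sub>m nb * Q' = 1\<^sub>m nb" using a b by auto
  have c: "kron C D \<in> carrier_mat ?n ?n"
    if "C \<in> carrier_mat na na" "D \<in> carrier_mat nb nb" for C D :: "'a mat"
    using that by (rule kron_carrier)
  have lin: "?R * (s \<cdot>\<^sub>m X) * ?R' = s \<cdot>\<^sub>m (?R * X * ?R')" if "X \<in> carrier_mat ?n ?n" for X s
    using that R by (simp add: mult_smult_distrib[of _ ?n ?n _ ?n] mult_smult_assoc_mat[of _ ?n ?n _ ?n])
  have add: "?R * (X + Y) * ?R' = ?R * X * ?R' + ?R * Y * ?R'"
    if "X \<in> carrier_mat ?n ?n" "Y \<in> carrier_mat ?n ?n" for X Y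
    using that R by (simp add: mult_add_distrib_mat[of _ ?n ?n _ ?n] add_mult_distrib_mat[of _ ?n ?n _ _ ?n])
  have e: "kron (1\<^sub>m na) (1\<^sub>m nb) = ?R * kron (1\<^sub>m na) (1\<^sub>m nb) * ?R'"
    "kron A (1\<^sub>m nb) = ?R * kron A' (1\<^sub>m nb) * ?R'"
    "kron (1\<^sub>m na) B = ?R * kron (1\<^sub>m na) B' * ?R'"
    "kron A B = ?R * kron A' B' * ?R'"
    using conj[of "1\<^sub>m na" "1\<^sub>m nb"] conj[of A' "1\<^sub>m nb"] conj[of "1\<^sub>m na" B'] conj[of A' B'] a(3,5) b(3,5) 1
    by auto
  have ca: "1\<^sub>m na \<in> carrier_mat na na" "1\<^sub>m nb \<in> carrier_mat nb nb" by auto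
  have "kron_comb c0 c1 c2 c3 na nb A B = ?R * kron_comb c0 c1 c2 c3 na nb A' B' * ?R'"
    unfolding kron_comb_def
    by (subst e(1), subst e(2), subst e(3), subst e(4))
      (simp only: lin add add_carrier_mat smult_carrier_mat c ca a(5) b(5))
  moreover have "?R * ?R' = 1\<^sub>m ?n" "?R' * ?R = 1\<^sub>m ?n"
    using a b by (simp_all add: kron_mult[of _ na _ nb] kron_one)
  ultimately have "similar_mat_wit (kron_comb c0 c1 c2 c3 na nb A B)
      (kron_comb c0 c1 c2 c3 na nb A' B') ?R ?R'"
    using R kron_comb_carrier[OF Ac Bc] kron_comb_carrier[OF a(5) b(5)]
    by (intro similar_mat_witI[of _ _ ?n])
  then show ?thesis by (auto simp: similar_mat_def)
qed

section \<open>Eigenvalues with algebraic multiplicity through triangularization\<close>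

lemma eigenvalue_mset_prod_list:
  assumes "char_poly A = (\<Prod>a\<leftarrow>as. [:- a, 1:])"
  shows "eigenvalue_mset A = mset as"
proof -
  have "proots (\<Prod>a\<leftarrow>as. [:- a, 1:]) = mset as"
  proof (induction as)
    case (Cons a as)
    have "(\<Prod>a\<leftarrow>as. [:- a, 1:]) \<noteq> 0" by (auto simp: prod_list_zero_iff)
    then show ?case by (simp add: proots_mult Cons.IH del: mult_pCons_left)
  qed simp
  then show ?thesis by (simp add: eigenvalue_mset_def assms)
qed

lemma spectrum_eq_eigenvalue_mset:
  assumes "A \<in> carrier_mat n n"
  shows "spectrum A = set_mset (eigenvalue_mset A)"
proof -
  have "char_poly A \<noteq> 0" using degree_monic_char_poly[OF assms] by auto
  then show ?thesis
    by (simp add: eigenvalue_mset_def spectrum_root_char_poly[OF assms])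
qed

text \<open>The list \<open>as\<close> may be any ordering of the roots, and the diagonal follows
  it. This freedom later puts a supposed double root in the first two diagonal places.\<close>

lemma schur_ex:
  fixes A :: "complex mat"
  assumes "A \<in> carrier_mat n n" and "char_poly A = (\<Prod>a\<leftarrow>as. [:- a, 1:])"
  obtains T P Q where "similar_mat_wit A T P Q" "upper_triangular T" "diag_mat T = as"
  by (metis assms prod_cases3 schur_decomposition)

text \<open>Positions are ordered lexicographically by quotient and remainder. Below the diagonal
  either the column quotient is smaller, which kills the entries of \<open>A\<close> and of the left
  identity, or the quotients agree and the column remainder is smaller, which does the same for
  \<open>B\<close> and the right identity.\<close>

lemma upper_triangular_kron_comb:
  assumes A: "A \<in> carrier_mat na na" and B: "B \<in> carrier_mat nb nb"
    and "upper_triangular A" "upper_triangular B"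
  shows "upper_triangular (kron_comb c0 c1 c2 c3 na nb A B)"
proof (rule upper_triangularI)
  fix p q assume q: "q < p" and "p < dim_row (kron_comb c0 c1 c2 c3 na nb A B)"
  hence p: "p < na * nb" using kron_comb_carrier[OF A B, of c0 c1 c2 c3] by auto
  have "q div nb \<le> p div nb" using q by (simp add: div_le_mono)
  then consider "q div nb < p div nb" | "q div nb = p div nb" "q mod nb < p mod nb"
    using q div_mult_mod_eq[of q nb] div_mult_mod_eq[of p nb]
    by (metis le_neq_implies_less nat_add_left_cancel_less)
  then show "kron_comb c0 c1 c2 c3 na nb A B $$ (p, q) = 0"
  proof cases
    case 1
    then have "A $$ (p div nb, q div nb) = 0"
      using assms div_mod_less[OF p] by (intro upper_triangularD) auto
    with 1 show ?thesis using p q by (simp add: index_kron_comb[OF A B] Let_def)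
  next
    case 2
    then have "B $$ (p mod nb, q mod nb) = 0"
      using assms div_mod_less[OF p] by (intro upper_triangularD) auto
    with 2 show ?thesis using p q by (simp add: index_kron_comb[OF A B] Let_def)
  qed
qed

text \<open>Schur forms of \<open>A\<close> and \<open>B\<close> triangularize the whole combination
  simultaneously, and its diagonal lists the values of the polynomial at all pairs of eigenvalues,
  repetitions included.\<close>

lemma eigenvalue_mset_kron_comb:
  assumes A: "A \<in> carrier_mat na na" and B: "B \<in> carrier_mat nb nb"
  shows "eigenvalue_mset (kron_comb c0 c1 c2 c3 na nb A B)
    = (\<Sum>l\<in>#eigenvalue_mset A. {#c0 + c1 * l + c2 * m + c3 * (l * m). m \<in># eigenvalue_mset B#})"
proof -
  obtain as where as: "char_poly A = (\<Prod>a\<leftarrow>as. [:- a, 1:])" using char_poly_factorized[OF A] by blast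
  obtain bs where bs: "char_poly B = (\<Prod>a\<leftarrow>bs. [:- a, 1:])" using char_poly_factorized[OF B] by blast
  obtain S P P' where S: "similar_mat_wit A S P P'" "upper_triangular S" "diag_mat S = as"
    using schur_ex[OF A as] .
  obtain T Q Q' where T: "similar_mat_wit B T Q Q'" "upper_triangular T" "diag_mat T = bs"
    using schur_ex[OF B bs] .
  have Sc: "S \<in> carrier_mat na na" using similar_mat_witD2[OF A S(1)] by auto
  have Tc: "T \<in> carrier_mat nb nb" using similar_mat_witD2[OF B T(1)] by auto
  let ?K = "kron_comb c0 c1 c2 c3 na nb S T"
  have "char_poly (kron_comb c0 c1 c2 c3 na nb A B) = char_poly ?K"
    by (rule char_poly_similar[OF kron_comb_similar[OF S(1) T(1) A B]])
  also have "\<dots> = (\<Prod>a\<leftarrow>diag_mat ?K. [:- a, 1:])"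
    by (rule char_poly_upper_triangular[OF kron_comb_carrier[OF Sc Tc]
          upper_triangular_kron_comb[OF Sc Tc S(2) T(2)]])
  finally have "eigenvalue_mset (kron_comb c0 c1 c2 c3 na nb A B) = mset (diag_mat ?K)"
    by (rule eigenvalue_mset_prod_list)
  also have "diag_mat ?K = map (\<lambda>p. (\<lambda>i j. c0 + c1 * S $$ (i, i) + c2 * T $$ (j, j)
      + c3 * (S $$ (i, i) * T $$ (j, j))) (p div nb) (p mod nb)) [0..<na * nb]"
    using kron_comb_carrier[OF Sc Tc, of c0 c1 c2 c3]
    by (auto simp: diag_mat_def index_kron_comb[OF Sc Tc] Let_def)
  also have "mset \<dots> = (\<Sum>i\<in>#mset [0..<na]. {#c0 + c1 * S $$ (i, i) + c2 * T $$ (j, j)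
      + c3 * (S $$ (i, i) * T $$ (j, j)). j \<in># mset [0..<nb]#})"
    by (rule mset_div_mod)
  also have "\<dots> = (\<Sum>l\<in>#mset as. {#c0 + c1 * l + c2 * m + c3 * (l * m). m \<in># mset bs#})"
    using Sc Tc
    by (simp add: diag_mat_def image_mset.compositionality comp_def flip: S(3) T(3))
  finally show ?thesis
    by (simp add: eigenvalue_mset_prod_list[OF as] eigenvalue_mset_prod_list[OF bs])
qed

subsection \<open>Eventually positive matrices\<close>

lemma mult_mat_vec_sum:
  assumes "A \<in> carrier_mat n m" "v \<in> carrier_vec m" "i < n"
  shows "(A *\<^sub>v v) $ i = (\<Sum>j<m. A $$ (i, j) * v $ j)"
  using assms by (auto simp: scalar_prod_def atLeast0LessThan intro!: sum.cong)

lemma pow_mat_mult_exp: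
  assumes A: "(A :: 'a :: semiring_1 mat) \<in> carrier_mat n n"
  shows "A ^\<^sub>m (k * Suc m) = A ^\<^sub>m k * A ^\<^sub>m (k * m)"
proof -
  have add: "A ^\<^sub>m (i + j) = A ^\<^sub>m i * A ^\<^sub>m j" for i j
  proof (induction j)
    case (Suc j)
    then show ?case using A by (simp add: assoc_mult_mat[of _ n n _ n _ n])
  qed (use A in auto)
  show ?thesis by (simp add: add)
qed

lemma smult_pow_mat:
  assumes A: "(A :: 'a :: comm_semiring_1 mat) \<in> carrier_mat n n"
  shows "(c \<cdot>\<^sub>m A) ^\<^sub>m k = c ^ k \<cdot>\<^sub>m (A ^\<^sub>m k)"
proof (induction k)
  case (Suc k)
  then show ?case
    using A by (auto intro!: eq_matI simp: mult_ac scalar_prod_def sum_distrib_left)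
qed (use A in \<open>auto intro!: eq_matI\<close>)

lemma cmat_pow:
  assumes "A \<in> carrier_mat n n"
  shows "cmat (A ^\<^sub>m k) = cmat A ^\<^sub>m k"
  by (rule of_real_hom.mat_hom_pow[OF assms])

lemma transpose_pow_mat:
  assumes A: "(A :: 'a :: comm_semiring_1 mat) \<in> carrier_mat n n"
  shows "transpose_mat (A ^\<^sub>m k) = transpose_mat A ^\<^sub>m k"
proof -
  have "transpose_mat A ^\<^sub>m (Suc k) = transpose_mat A * transpose_mat A ^\<^sub>m k" for k
    using pow_mat_mult_exp[of "transpose_mat A" n 1 k] A by simp
  then show ?thesis
  proof (induction k)
    case (Suc k)
    have "transpose_mat (A ^\<^sub>m Suc k) = transpose_mat A * transpose_mat (A ^\<^sub>m k)"
      using A by (simp add: transpose_mult[of _ n n _ n])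
    with Suc show ?case by simp
  qed (use A in auto)
qed

section \<open>Growth of matrix powers and Perron eigenvectors\<close>

lemma spectral_radius_attained:
  assumes "A \<in> carrier_mat n n" "n > 0"
  obtains v l where "eigenvector A v l" "norm l = spectral_radius A"
  using spectral_radius_mem_max(1)[OF assms] by (auto simp: spectrum_def eigenvalue_def)

lemma norm_eigenvalue_le_spectral_radius:
  assumes "A \<in> carrier_mat n n" "n > 0" "eigenvalue A l"
  shows "norm l \<le> spectral_radius A"
  using assms by (intro spectral_radius_mem_max(2)[OF assms(1,2)]) (auto simp: spectrum_def)

text \<open>
  A subinvariant vector makes the powers of \<open>B\<close> grow at rate \<open>t\<close>, whereas powers of \<open>B\<close>
  scaled to spectral radius below 1 stay bounded.
\<close>
lemma subinvariant_spectral_radius: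
  fixes B :: "real mat" and x :: "nat \<Rightarrow> real"
  assumes B: "B \<in> carrier_mat n n" and k: "k > 0" and t: "t > 0"
    and nonneg: "\<And>i j. i < n \<Longrightarrow> j < n \<Longrightarrow> (B ^\<^sub>m k) $$ (i, j) \<ge> 0"
    and x: "\<And>i. i < n \<Longrightarrow> x i \<ge> 0" and i: "i < n" "x i > 0"
    and sub: "\<And>i. i < n \<Longrightarrow> t * x i \<le> (\<Sum>j<n. (B ^\<^sub>m k) $$ (i, j) * x j)"
  shows "t \<le> spectral_radius (cmat B) ^ k"
proof (rule ccontr)
  let ?r = "spectral_radius (cmat B)"
  assume "\<not> t \<le> ?r ^ k"
  hence less: "?r ^ k < t" by simp
  have n: "n > 0" using i by auto
  have C: "cmat B \<in> carrier_mat n n" using B by auto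
  have r0: "?r \<ge> 0"
    by (rule spectral_radius_attained[OF C n]) (metis norm_ge_zero)
  \<comment> \<open>The \<open>k\<close>-th root of the midpoint leaves room on both sides: the
    spectral radius is below \<open>s\<close>, while \<open>s ^ k\<close> is below
    \<open>t\<close>.\<close>
  define s where "s = root k ((?r ^ k + t) / 2)"
  have half: "(?r ^ k + t) / 2 > 0" using add_nonneg_pos[OF zero_le_power[OF r0] t] by simp
  have sk: "s ^ k = (?r ^ k + t) / 2"
    unfolding s_def by (rule real_root_pow_pos[OF k half])
  have s0: "s > 0" unfolding s_def by (rule real_root_gt_zero[OF k half])
  have sr: "?r < s"
  proof (rule power_less_imp_less_base)
    show "?r ^ k < s ^ k" unfolding sk using less by simp
  qed (use s0 in simp)
  define D where "D = complex_of_real (inverse s) \<cdot>\<^sub>m cmat B"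
  have D: "D \<in> carrier_mat n n" using C by (simp add: D_def)
  obtain w m where w: "eigenvector D w m" "norm m = spectral_radius D"
    using spectral_radius_attained[OF D n] .
  have wc: "w \<in> carrier_vec n" "w \<noteq> 0\<^sub>v n" "D *\<^sub>v w = m \<cdot>\<^sub>v w"
    using w(1) D by (auto simp: eigenvector_def)
  have "cmat B *\<^sub>v w = (s * m) \<cdot>\<^sub>v w"
  proof (rule eq_vecI)
    fix i assume "i < dim_vec ((s * m) \<cdot>\<^sub>v w)"
    hence i: "i < n" using wc by auto
    have "(D *\<^sub>v w) $ i = inverse s * (cmat B *\<^sub>v w) $ i"
      unfolding mult_mat_vec_sum[OF D wc(1) i] mult_mat_vec_sum[OF C wc(1) i]
      using i C by (simp add: D_def sum_distrib_left mult_ac)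
    then have "inverse s * (cmat B *\<^sub>v w) $ i = m * w $ i" using wc i by simp
    then show "(cmat B *\<^sub>v w) $ i = ((s * m) \<cdot>\<^sub>v w) $ i"
      using s0 i wc by (simp add: field_simps del: index_mult_mat_vec)
  qed (use wc C in auto)
  then have "eigenvalue (cmat B) (s * m)"
    using wc C by (auto simp: eigenvalue_def eigenvector_def)
  from norm_eigenvalue_le_spectral_radius[OF C n this] have "s * norm m \<le> ?r"
    using s0 by (simp add: norm_mult)
  also note sr
  finally have "spectral_radius D < 1" using s0 w(2) by simp
  from spectral_radius_jnf_norm_bound_less_1_upper_triangular[OF D this]
  obtain c where c: "\<And>q. norm_bound (D ^\<^sub>m q) c" by auto
  have bound: "(B ^\<^sub>m q) $$ (i, j) \<le> c * s ^ q" if "i < n" "j < n" for i j q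
  proof -
    have "norm ((D ^\<^sub>m q) $$ (i, j)) \<le> c" using c[of q] that D by (auto simp: norm_bound_def)
    moreover have "D ^\<^sub>m q = complex_of_real (inverse s) ^ q \<cdot>\<^sub>m cmat (B ^\<^sub>m q)"
      by (simp only: D_def smult_pow_mat[OF C] cmat_pow[OF B])
    ultimately have "inverse s ^ q * \<bar>(B ^\<^sub>m q) $$ (i, j)\<bar> \<le> c"
      using that B s0 by (simp add: norm_mult norm_power norm_inverse)
    hence "\<bar>(B ^\<^sub>m q) $$ (i, j)\<bar> \<le> c * s ^ q"
      using s0 by (simp add: field_simps power_inverse)
    thus ?thesis by linarith
  qed
  \<comment> \<open>Nonnegativity of the \<open>k\<close>-th power lets the subinvariance inequality
    be iterated.\<close>
  have grow: "\<forall>i<n. t ^ q * x i \<le> (\<Sum>j<n. (B ^\<^sub>m (k * q)) $$ (i, j) * x j)" for q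
  proof (induction q)
    case 0
    show ?case using B by (simp add: if_distrib[of "\<lambda>a. a * _"] cong: if_cong)
  next
    case (Suc q)
    show ?case
    proof (intro allI impI)
      fix i assume i: "i < n"
      have "t ^ Suc q * x i = t ^ q * (t * x i)" by simp
      also have "\<dots> \<le> t ^ q * (\<Sum>j<n. (B ^\<^sub>m k) $$ (i, j) * x j)"
        using t sub[OF i] by (intro mult_left_mono) auto
      also have "\<dots> = (\<Sum>j<n. (B ^\<^sub>m k) $$ (i, j) * (t ^ q * x j))"
        by (simp add: sum_distrib_left mult_ac)
      also have "\<dots> \<le> (\<Sum>j<n. (B ^\<^sub>m k) $$ (i, j) * (\<Sum>l<n. (B ^\<^sub>m (k * q)) $$ (j, l) * x l))"
        using nonneg i Suc.IH by (intro sum_mono mult_left_mono) auto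
      also have "\<dots> = (\<Sum>l<n. (\<Sum>j<n. (B ^\<^sub>m k) $$ (i, j) * (B ^\<^sub>m (k * q)) $$ (j, l)) * x l)"
        by (simp add: sum_distrib_left sum_distrib_right mult_ac) (rule sum.swap)
      also have "\<dots> = (\<Sum>l<n. (B ^\<^sub>m (k * Suc q)) $$ (i, l) * x l)"
        unfolding pow_mat_mult_exp[OF B] using B i
        by (intro sum.cong refl, subst index_mult_mat_sum[of _ n n _ n]) auto
      finally show "t ^ Suc q * x i \<le> (\<Sum>l<n. (B ^\<^sub>m (k * Suc q)) $$ (i, l) * x l)" .
    qed
  qed
  \<comment> \<open>Growth at rate \<open>t\<close> meets the bound of order \<open>s ^ k\<close>
    per block of \<open>k\<close> factors, so the powers of a number above 1 would stay
    bounded.\<close>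
  have "(t / s ^ k) ^ q \<le> c * (\<Sum>j<n. x j) / x i" for q
  proof -
    have "t ^ q * x i \<le> (\<Sum>j<n. (B ^\<^sub>m (k * q)) $$ (i, j) * x j)" using grow i by blast
    also have "\<dots> \<le> (\<Sum>j<n. c * s ^ (k * q) * x j)"
      using bound i x by (intro sum_mono mult_right_mono) auto
    also have "\<dots> = c * (\<Sum>j<n. x j) * s ^ (k * q)" by (simp add: sum_distrib_left mult_ac)
    finally show ?thesis using i s0 by (simp add: field_simps power_mult)
  qed
  moreover have "t / s ^ k > 1" using sk less half by (simp add: field_simps)
  from real_arch_pow[OF this] obtain q where "c * (\<Sum>j<n. x j) / x i < (t / s ^ k) ^ q" by blast
  ultimately show False by (simp add: not_less[symmetric])
qed

text \<open>Let \<open>x\<close> be the vector of moduli of \<open>v\<close>. The triangle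
  inequality makes \<open>x\<close> subinvariant under each positive power of \<open>B\<close>, and
  strictness in a single entry would push the growth rate above the spectral radius. Hence equality
  holds everywhere, which forces nonzero entries with a common phase. This covers every eigenvector
  whose eigenvalue has maximal modulus, so it also excludes other eigenvalues on the spectral
  circle.\<close>

lemma perron_eigenvector:
  assumes ep: "eventually_positive n B" and n: "n > 0"
    and ev: "eigenvector (cmat B) v l" and l: "norm l = spectral_radius (cmat B)"
  shows "l = of_real (spectral_radius (cmat B))" "spectral_radius (cmat B) > 0"
    "\<exists>c. \<forall>j<n. c * v $ j = of_real (norm (v $ j)) \<and> v $ j \<noteq> 0"
proof -
  let ?r = "spectral_radius (cmat B)"
  obtain k0 where B: "B \<in> carrier_mat n n"
    and pos: "\<And>k i j. k > k0 \<Longrightarrow> i < n \<Longrightarrow> j < n \<Longrightarrow> (B ^\<^sub>m k) $$ (i, j) > 0"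
    using ep unfolding eventually_positive_def by blast
  have C: "cmat B \<in> carrier_mat n n" using B by auto
  have v: "v \<in> carrier_vec n" "v \<noteq> 0\<^sub>v n" using ev C by (auto simp: eigenvector_def)
  have ne: "{..<n} \<noteq> {}" using n by (auto simp: lessThan_empty_iff)
  let ?x = "\<lambda>i. norm (v $ i)"
  obtain i1 where i1: "i1 < n" "?x i1 > 0" using v by (metis eq_vecI carrier_vecD index_zero_vec zero_less_norm_iff)
  show r0: "?r > 0"
  proof -
    define P where "P = B ^\<^sub>m Suc k0"
    \<comment> \<open>The least row sum of a positive power is a growth rate for the all-ones
      vector, so the spectral radius cannot be 0.\<close>
    define t where "t = Min ((\<lambda>i. \<Sum>j<n. P $$ (i, j)) ` {..<n})"
    have P: "P $$ (i, j) > 0" if "i < n" "j < n" for i j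
      unfolding P_def using that by (intro pos) auto
    have "t > 0" unfolding t_def using ne
      by (subst Min_gr_iff) (auto intro!: sum_pos P)
    moreover have "t \<le> ?r ^ Suc k0"
      by (rule subinvariant_spectral_radius[OF B _ \<open>t > 0\<close>, of _ "\<lambda>_. 1" 0])
        (use n P in \<open>auto simp: t_def simp flip: P_def simp del: pow_mat.simps intro!: less_imp_le Min_le\<close>)
    ultimately have "?r ^ Suc k0 > 0" by linarith
    moreover have "?r \<ge> 0" using l by (metis norm_ge_zero)
    ultimately show ?thesis by (metis less_eq_real_def power_0_Suc order_less_irrefl)
  qed
  have evk: "(\<Sum>j<n. of_real ((B ^\<^sub>m k) $$ (i, j)) * v $ j) = l ^ k * v $ i" if "i < n" for i k
  proof -
    have "(cmat (B ^\<^sub>m k) *\<^sub>v v) $ i = (l ^ k \<cdot>\<^sub>v v) $ i"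
      unfolding cmat_pow[OF B] eigenvector_pow[OF C ev] ..
    then show ?thesis
      using that v B by (subst (asm) mult_mat_vec_sum[of _ n n]) auto
  qed
  have eq: "(\<Sum>j<n. (B ^\<^sub>m k) $$ (i, j) * ?x j) = ?r ^ k * ?x i" if k: "k > k0" and i: "i < n" for k i
  proof (rule ccontr)
    define P where "P = B ^\<^sub>m k"
    note P = pos[OF k, folded P_def]
    define y where "y i = (\<Sum>j<n. P $$ (i, j) * ?x j)" for i
    have ge: "?r ^ k * ?x i \<le> y i" if "i < n" for i
    proof -
      have "?r ^ k * ?x i = norm (\<Sum>j<n. of_real (P $$ (i, j)) * v $ j)"
        using evk[OF that] by (simp add: P_def norm_mult norm_power l)
      also have "\<dots> \<le> y i"
        unfolding y_def using P that by (intro sum_norm_le) (simp add: norm_mult less_imp_le)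
      finally show ?thesis .
    qed
    assume "(\<Sum>j<n. (B ^\<^sub>m k) $$ (i, j) * ?x j) \<noteq> ?r ^ k * ?x i"
    hence strict: "?r ^ k * ?x i < y i" using ge[OF i] by (simp add: y_def P_def)
    have ypos: "y i > 0" if "i < n" for i
      unfolding y_def using P that i1 by (intro sum_pos2[of _ i1]) (auto intro!: mult_nonneg_nonneg less_imp_le[OF P])
    \<comment> \<open>One more application of the positive matrix spreads the strictness at
      \<open>i\<close> to every row.\<close>
    have gt: "?r ^ k * y i' < (\<Sum>j<n. P $$ (i', j) * y j)" if "i' < n" for i'
    proof -
      have "?r ^ k * y i' = (\<Sum>j<n. P $$ (i', j) * (?r ^ k * ?x j))"
        by (simp add: y_def sum_distrib_left mult_ac)
      also have "\<dots> < (\<Sum>j<n. P $$ (i', j) * y j)"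
        using P[OF that] ge strict i
        by (intro sum_strict_mono_ex1) (auto intro!: mult_left_mono mult_strict_left_mono less_imp_le bexI[of _ i])
      finally show ?thesis .
    qed
    \<comment> \<open>The Collatz-Wielandt quotient of \<open>y\<close>: the largest rate for which
      \<open>y\<close> is subinvariant.\<close>
    define t where "t = Min ((\<lambda>i. (\<Sum>j<n. P $$ (i, j) * y j) / y i) ` {..<n})"
    have t: "t > ?r ^ k" unfolding t_def using ne gt ypos
      by (subst Min_gr_iff) (auto simp: field_simps)
    have "t \<le> ?r ^ k"
    proof (rule subinvariant_spectral_radius[OF B])
      show "t > 0" using t r0 by (meson less_trans zero_less_power)
      show "0 < y i" "i < n" by (rule ypos[OF i], rule i)
      fix i assume i: "i < n"
      have "t \<le> (\<Sum>j<n. P $$ (i, j) * y j) / y i" unfolding t_def using i by (intro Min_le) auto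
      thus "t * y i \<le> (\<Sum>j<n. (B ^\<^sub>m k) $$ (i, j) * y j)"
        using ypos[OF i] by (simp add: field_simps P_def)
    qed (use k P ypos in \<open>auto simp: P_def intro: less_imp_le\<close>)
    with t show False by simp
  qed
  have xpos: "?x i > 0" if "i < n" for i
  proof -
    have "0 < (\<Sum>j<n. (B ^\<^sub>m Suc k0) $$ (i, j) * ?x j)"
      using that i1 pos[OF lessI]
      by (intro sum_pos2[of _ i1]) (auto simp del: pow_mat.simps intro!: mult_nonneg_nonneg less_imp_le[OF pos])
    with eq[OF lessI that] show ?thesis using r0 by (simp add: zero_less_mult_iff)
  qed
  text \<open>Equality in the triangle inequality for the first row of a positive power aligns all phases.\<close>
  define k where "k = Suc k0"
  \<comment> \<open>The denominator is the modulus of \<open>l ^ k * v $ 0\<close>, so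
    \<open>c\<close> is the unit number that rotates the first entry of the \<open>k\<close>-th
    power applied to \<open>v\<close> onto the positive real axis.\<close>
  define c where "c = cnj (l ^ k * v $ 0) / of_real (?r ^ k * ?x 0)"
  have nc: "norm c = 1" using xpos[OF n] r0 by (simp add: c_def norm_mult norm_power norm_divide l)
  have "(\<Sum>j<n. (B ^\<^sub>m k) $$ (0, j) * (?x j - Re (c * v $ j))) = 0"
  proof -
    have "(\<Sum>j<n. of_real ((B ^\<^sub>m k) $$ (0, j)) * (c * v $ j)) = c * (l ^ k * v $ 0)"
      unfolding evk[OF n, symmetric] by (simp add: sum_distrib_left mult_ac)
    also have "\<dots> = of_real ((norm (l ^ k * v $ 0))\<^sup>2) / of_real (?r ^ k * ?x 0)"
      unfolding c_def complex_norm_square by simp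
    also have "\<dots> = of_real (?r ^ k * ?x 0)"
      using xpos[OF n] r0 by (simp add: norm_mult norm_power l power2_eq_square)
    finally have "Re (\<Sum>j<n. of_real ((B ^\<^sub>m k) $$ (0, j)) * (c * v $ j)) = ?r ^ k * ?x 0" by simp
    moreover have Rm: "Re (of_real a * z) = a * Re z" for a z by simp
    ultimately have "(\<Sum>j<n. (B ^\<^sub>m k) $$ (0, j) * Re (c * v $ j)) = ?r ^ k * ?x 0"
      by (simp add: Rm del: times_complex.sel)
    thus ?thesis using eq[of k 0] n by (simp add: k_def algebra_simps sum_subtractf del: times_complex.sel pow_mat.simps)
  qed
  moreover have le: "Re (c * v $ j) \<le> ?x j" for j
    using complex_Re_le_cmod[of "c * v $ j"] by (simp add: norm_mult nc)
  \<comment> \<open>A vanishing sum of nonnegative terms; the weights are positive, so each real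
    part must equal its modulus.\<close>
  ultimately have zero: "(B ^\<^sub>m k) $$ (0, j) * (?x j - Re (c * v $ j)) = 0" if "j < n" for j
    using that pos[of k 0] n
    by (subst (asm) sum_nonneg_eq_0_iff)
      (auto simp: k_def less_imp_le simp del: times_complex.sel pow_mat.simps intro!: mult_nonneg_nonneg)
  have Re: "Re (c * v $ j) = ?x j" if "j < n" for j
    using zero[OF that] pos[of k 0 j] that n by (auto simp: k_def simp del: times_complex.sel pow_mat.simps)
  have align: "c * v $ j = of_real (?x j)" if "j < n" for j
  proof -
    have "norm (c * v $ j) = Re (c * v $ j)" using Re[OF that] by (simp add: norm_mult nc)
    hence "Im (c * v $ j) = 0" 
      using cmod_power2[of "c * v $ j"] by (simp del: times_complex.sel)
    thus ?thesis using Re[OF that] by (simp add: complex_eq_iff)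
  qed
  show "\<exists>c. \<forall>j<n. c * v $ j = of_real (?x j) \<and> v $ j \<noteq> 0"
    using align xpos by (intro exI[of _ c]) auto
  have lk: "l ^ k = of_real ?r ^ k" if k: "k > k0" for k
  proof -
    have "l ^ k * of_real (?x 0) = c * (l ^ k * v $ 0)" using align[OF n] by (simp add: mult_ac)
    also have "\<dots> = (\<Sum>j<n. of_real ((B ^\<^sub>m k) $$ (0, j)) * (c * v $ j))"
      unfolding evk[OF n, symmetric] by (simp add: sum_distrib_left mult_ac)
    also have "\<dots> = of_real (\<Sum>j<n. (B ^\<^sub>m k) $$ (0, j) * ?x j)" by (simp add: align)
    also have "\<dots> = of_real ?r ^ k * of_real (?x 0)" unfolding eq[OF k n] by simp
    finally show ?thesis using xpos[OF n] by simp
  qed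
  \<comment> \<open>A single exponent determines \<open>l\<close> only up to a root of unity; the
    quotient of two consecutive ones determines it fully.\<close>
  have "l * l ^ Suc k0 = of_real ?r * of_real ?r ^ Suc k0"
    using lk[of "Suc (Suc k0)"] by simp
  thus "l = of_real ?r" using lk[of "Suc k0"] r0 by simp
qed

section \<open>Simplicity of the Perron root and its invariance under switching\<close>

lemma eventually_positive_transpose:
  assumes "eventually_positive n B"
  shows "eventually_positive n (transpose_mat B)"
proof -
  obtain k0 where B: "B \<in> carrier_mat n n" and k0: "k0 > 0"
    and pos: "\<And>k i j. k > k0 \<Longrightarrow> i < n \<Longrightarrow> j < n \<Longrightarrow> (B ^\<^sub>m k) $$ (i, j) > 0"
    using assms unfolding eventually_positive_def by blast
  have "(transpose_mat B ^\<^sub>m k) $$ (i, j) > 0" if "k > k0" "i < n" "j < n" for k i j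
    unfolding transpose_pow_mat[OF B, symmetric] using that B pos by simp
  then show ?thesis using B k0 unfolding eventually_positive_def by auto
qed

text \<open>Suppose the Perron root \<open>r\<close> were a double root. A Schur form then yields
  independent vectors \<open>p0\<close> and \<open>p1\<close> with \<open>C p0 = r p0\<close> and
  \<open>C p1 = t p0 + r p1\<close>. Pairing with a left Perron vector forces \<open>t = 0\<close>,
  so the eigenspace has dimension at least two and contains a nonzero vector with a zero entry,
  against \<open>perron_eigenvector\<close>.\<close>

lemma eventually_positive_perron:
  assumes ep: "eventually_positive n B" and n: "n > 0"
  obtains \<rho> N where "\<rho> > 0" "eigenvalue_mset (cmat B) = add_mset (complex_of_real \<rho>) N"
    "\<And>m. m \<in># N \<Longrightarrow> Re m < \<rho>"
proof -
  let ?r = "spectral_radius (cmat B)" and ?C = "cmat B"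
  have B: "B \<in> carrier_mat n n" using ep by (simp add: eventually_positive_def)
  have C: "?C \<in> carrier_mat n n" using B by auto
  note perron = perron_eigenvector[OF ep n]
  obtain v l where vl: "eigenvector ?C v l" "norm l = ?r" using spectral_radius_attained[OF C n] .
  have r0: "?r > 0" using perron(2)[OF vl] .
  have "of_real ?r \<in># eigenvalue_mset ?C"
    using vl(1) unfolding perron(1)[OF vl] spectrum_eq_eigenvalue_mset[OF C, symmetric]
    by (auto simp: spectrum_def eigenvalue_def)
  then obtain N where N: "eigenvalue_mset ?C = add_mset (of_real ?r) N" by (metis insert_DiffM)
  have simple: "of_real ?r \<notin># N"
  proof
    assume "of_real ?r \<in># N"
    then obtain N' where N': "N = add_mset (of_real ?r) N'" by (metis insert_DiffM)
    obtain as where as: "char_poly ?C = (\<Prod>a\<leftarrow>as. [:- a, 1:])" using char_poly_factorized[OF C] by blast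
    obtain es where es: "mset es = N'" using ex_mset by blast
    \<comment> \<open>The double root goes first, so that the first two Schur columns span an
      invariant plane.\<close>
    let ?es = "of_real ?r # of_real ?r # es"
    have m: "mset as = mset ?es" using eigenvalue_mset_prod_list[OF as] N N' es by simp
    have "char_poly ?C = (\<Prod>a\<leftarrow>?es. [:- a, 1:])"
      unfolding as using arg_cong[OF m, of "\<lambda>M. prod_mset (image_mset (\<lambda>a. [:- a, 1:]) M)"]
      by (simp only: mset_map[symmetric] prod_mset_prod_list)
    then obtain T P Q where T: "similar_mat_wit ?C T P Q" "upper_triangular T" "diag_mat T = ?es"
      using schur_ex[OF C] by blast
    note sim = similar_mat_witD2[OF C T(1)]
    have Tn: "length (diag_mat T) = n" using sim by (simp add: diag_mat_def)
    hence n2: "1 < n" unfolding T(3) by auto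
    have d: "T $$ (i, i) = diag_mat T ! i" if "i < n" for i using that sim by (simp add: diag_mat_def)
    have T00: "T $$ (0, 0) = of_real ?r" "T $$ (1, 1) = of_real ?r" "T $$ (1, 0) = 0"
      using d[of 0] d[of 1] n2 sim upper_triangularD[OF T(2), of 0 1] by (auto simp: T(3))
    have T0: "T $$ (i, 0) = 0" if "i < n" "i \<noteq> 0" for i using that sim upper_triangularD[OF T(2), of 0 i] by auto
    have T1: "T $$ (i, 1) = 0" if "i < n" "i \<noteq> 0" "i \<noteq> 1" for i
      using that sim upper_triangularD[OF T(2), of 1 i] by auto
    define p0 where "p0 = col P 0"
    define p1 where "p1 = col P 1"
    define t where "t = T $$ (0, 1)"
    have pc: "p0 \<in> carrier_vec n" "p1 \<in> carrier_vec n" using sim by (auto simp: p0_def p1_def)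
    have CP: "?C * P = P * T"
    proof -
      have "?C * P = P * T * (Q * P)" using sim by (simp add: assoc_mult_mat[of _ n n _ n _ n])
      thus ?thesis using sim by simp
    qed
    have colT: "col T 0 = of_real ?r \<cdot>\<^sub>v unit_vec n 0"
      "col T 1 = t \<cdot>\<^sub>v unit_vec n 0 + of_real ?r \<cdot>\<^sub>v unit_vec n 1"
      using sim n2 T00 T0 T1 by (auto intro!: eq_vecI simp: t_def unit_vec_def)
    have P0: "P *\<^sub>v unit_vec n i = col P i" if "i < n" for i
      using that sim by (auto intro!: eq_vecI)
    have C0: "?C *\<^sub>v p0 = of_real ?r \<cdot>\<^sub>v p0"
    proof -
      have "?C *\<^sub>v p0 = col (?C * P) 0" unfolding p0_def using sim n by (intro col_mult2[symmetric]) auto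
      also have "\<dots> = P *\<^sub>v col T 0" unfolding CP using sim n by (intro col_mult2) auto
      finally show ?thesis unfolding colT using sim(6) P0[OF n] by (simp add: mult_mat_vec[of _ n n] p0_def)
    qed
    have C1: "?C *\<^sub>v p1 = t \<cdot>\<^sub>v p0 + of_real ?r \<cdot>\<^sub>v p1"
    proof -
      have "?C *\<^sub>v p1 = col (?C * P) 1" unfolding p1_def using sim n2 by (intro col_mult2[symmetric]) auto
      also have "\<dots> = P *\<^sub>v col T 1" unfolding CP using sim n2 by (intro col_mult2) auto
      finally show ?thesis unfolding colT using sim(6) n P0[OF n] P0[OF n2]
        by (simp add: mult_mat_vec[of _ n n] mult_add_distrib_mat_vec[of _ n n] p0_def p1_def)
    qed
    have Qp: "Q *\<^sub>v p0 = unit_vec n 0" "Q *\<^sub>v p1 = unit_vec n 1"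
      unfolding p0_def p1_def using sim n n2 col_mult2[of Q n n P n 0] col_mult2[of Q n n P n 1] by auto
    have Q0: "Q *\<^sub>v 0\<^sub>v n = 0\<^sub>v n" using sim(7) by (auto intro!: eq_vecI)
    have p0nz: "p0 \<noteq> 0\<^sub>v n"
    proof
      assume "p0 = 0\<^sub>v n"
      hence "unit_vec n 0 = (0\<^sub>v n :: complex vec)" using Qp(1) Q0 by simp
      from arg_cong[OF this, of "\<lambda>v. v $ 0"] show False using n by simp
    qed
    have ev0: "eigenvector ?C p0 (of_real ?r)" using pc p0nz C0 B by (simp add: eigenvector_def)
    have nr: "norm (complex_of_real ?r) = ?r" using r0 by simp
    obtain c where c: "\<And>j. j < n \<Longrightarrow> c * p0 $ j = of_real (norm (p0 $ j)) \<and> p0 $ j \<noteq> 0"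
      using perron(3)[OF ev0 nr] by blast
    have "t = 0"
    proof -
      let ?D = "cmat (transpose_mat B)"
      have D: "?D \<in> carrier_mat n n" "?D = transpose_mat ?C" using B by auto
      note perronT = perron_eigenvector[OF eventually_positive_transpose[OF ep] n]
      obtain w m where wm: "eigenvector ?D w m" "norm m = spectral_radius ?D"
        using spectral_radius_attained[OF D(1) n] .
      have "spectrum ?D = spectrum ?C"
        using spectrum_root_char_poly[OF C] spectrum_root_char_poly[OF D(1)] D(2) C by simp
      hence "m = of_real ?r" using perronT(1)[OF wm] by (simp add: spectral_radius_def)
      hence w: "w \<in> carrier_vec n" "?D *\<^sub>v w = of_real ?r \<cdot>\<^sub>v w" using wm(1) D by (auto simp: eigenvector_def)
      obtain e where e: "\<And>j. j < n \<Longrightarrow> e * w $ j = of_real (norm (w $ j)) \<and> w $ j \<noteq> 0"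
        using perronT(3)[OF wm] by blast
      \<comment> \<open>Evaluating the pairing from both sides cancels the \<open>r\<close> terms
        and isolates \<open>t\<close>.\<close>
      have "of_real ?r * (w \<bullet> p1) = (?D *\<^sub>v w) \<bullet> p1" using w pc by simp
      also have "\<dots> = w \<bullet> (?C *\<^sub>v p1)"
        unfolding D(2) by (rule transpose_vec_mult_scalar[OF C pc(2) w(1)])
      also have "\<dots> = t * (w \<bullet> p0) + of_real ?r * (w \<bullet> p1)"
        unfolding C1 using w pc by (simp add: scalar_prod_add_distrib[of _ n])
      finally have "t * (w \<bullet> p0) = 0" by simp
      \<comment> \<open>After rotation by the phases \<open>e\<close> and \<open>c\<close> all
        summands are positive reals, so the pairing of left and right Perron vectors is
        nonzero.\<close>
      moreover have "e * c * (w \<bullet> p0) = of_real (\<Sum>j<n. norm (w $ j) * norm (p0 $ j))"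
      proof -
        have "e * c * (w \<bullet> p0) = (\<Sum>j<n. (e * w $ j) * (c * p0 $ j))"
          using pc by (simp add: scalar_prod_def atLeast0LessThan sum_distrib_left mult_ac)
        also have "\<dots> = (\<Sum>j<n. of_real (norm (w $ j)) * of_real (norm (p0 $ j)))"
          by (intro sum.cong refl arg_cong2[of _ _ _ _ "(*)"]) (use c e in auto)
        finally show ?thesis by simp
      qed
      moreover have "(\<Sum>j<n. norm (w $ j) * norm (p0 $ j)) > 0"
        using c e n by (intro sum_pos) (auto simp: lessThan_empty_iff)
      ultimately show ?thesis by (metis less_irrefl mult_eq_0_iff of_real_eq_0_iff)
    qed
    \<comment> \<open>The coefficients make entry 0 of \<open>z\<close> vanish; \<open>z\<close>
      itself is nonzero because its \<open>p1\<close> coordinate is \<open>p0 $ 0\<close>.\<close>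
    define z where "z = p0 $ 0 \<cdot>\<^sub>v p1 - p1 $ 0 \<cdot>\<^sub>v p0"
    have zc: "z \<in> carrier_vec n" using pc by (simp add: z_def)
    have "?C *\<^sub>v z = of_real ?r \<cdot>\<^sub>v z"
    proof -
      have "?C *\<^sub>v z = p0 $ 0 \<cdot>\<^sub>v (?C *\<^sub>v p1) - p1 $ 0 \<cdot>\<^sub>v (?C *\<^sub>v p0)"
        unfolding z_def using pc C by (simp add: mult_minus_distrib_mat_vec[of _ n n] mult_mat_vec[of _ n n])
      also have "\<dots> = of_real ?r \<cdot>\<^sub>v z"
        unfolding C0 C1 \<open>t = 0\<close> z_def using pc by (intro eq_vecI) (auto simp: algebra_simps)
      finally show ?thesis .
    qed
    moreover have "z \<noteq> 0\<^sub>v n"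
    proof
      assume "z = 0\<^sub>v n"
      hence "Q *\<^sub>v z = 0\<^sub>v n" using Q0 by simp
      moreover have "Q *\<^sub>v z = p0 $ 0 \<cdot>\<^sub>v unit_vec n 1 - p1 $ 0 \<cdot>\<^sub>v unit_vec n 0"
        using sim(7) pc Qp by (simp add: z_def mult_minus_distrib_mat_vec[of _ n n] mult_mat_vec[of _ n n])
      ultimately have "(p0 $ 0 \<cdot>\<^sub>v unit_vec n 1 - p1 $ 0 \<cdot>\<^sub>v unit_vec n 0) $ 1 = (0\<^sub>v n :: complex vec) $ 1" by simp
      thus False using c[OF n] n2 by simp
    qed
    ultimately have "eigenvector ?C z (of_real ?r)" using zc B by (simp add: eigenvector_def)
    from perron(3)[OF this nr] have "z $ 0 \<noteq> 0" using n by blast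
    thus False using pc n by (simp add: z_def)
  qed
  have "Re m < ?r" if m: "m \<in># N" for m
  proof (rule ccontr)
    \<comment> \<open>Then \<open>m\<close> would have maximal modulus, hence equal the Perron root,
      which does not occur a second time.\<close>
    assume "\<not> Re m < ?r"
    hence ge: "?r \<le> norm m" using complex_Re_le_cmod[of m] by simp
    have ev: "eigenvalue ?C m" using m N spectrum_eq_eigenvalue_mset[OF C] by (auto simp: spectrum_def)
    hence eq: "norm m = ?r" using norm_eigenvalue_le_spectral_radius[OF C n] ge by fastforce
    obtain x where "eigenvector ?C x m" using ev by (auto simp: eigenvalue_def)
    from perron(1)[OF this eq] m simple show False by simp
  qed
  with r0 N show ?thesis by (rule that)
qed

text \<open>A switching matrix is its own inverse, so switching is a similarity.\<close>

lemma eigenvalue_mset_switching: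
  assumes M: "switching_mat n M" and A: "A \<in> carrier_mat n n"
  shows "eigenvalue_mset (cmat (M * A * M)) = eigenvalue_mset (cmat A)"
proof -
  have Mc: "M \<in> carrier_mat n n" using M by (simp add: switching_mat_def)
  have MM: "M * M = 1\<^sub>m n"
  proof (rule eq_matI)
    fix i j assume "i < dim_row (1\<^sub>m n :: real mat)" "j < dim_col (1\<^sub>m n :: real mat)"
    hence ij: "i < n" "j < n" by auto
    have M0: "M $$ (i, k) = 0" if "i \<noteq> k" "k < n" for k
      using M ij that unfolding switching_mat_def diagonal_mat_def by auto
    have Mi: "M $$ (i, i) * M $$ (i, i) = 1" using M ij unfolding switching_mat_def by auto
    have "(M * M) $$ (i, j) = (\<Sum>k<n. M $$ (i, k) * M $$ (k, j))"
      by (rule index_mult_mat_sum[OF Mc Mc ij])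
    also have "\<dots> = (\<Sum>k\<in>{i}. M $$ (i, k) * M $$ (k, j))"
      using ij M0 by (intro sum.mono_neutral_right) auto
    also have "\<dots> = (1\<^sub>m n :: real mat) $$ (i, j)" using ij Mi M0[of j] by auto
    finally show "(M * M) $$ (i, j) = (1\<^sub>m n :: real mat) $$ (i, j)" .
  qed (use Mc in auto)
  have "cmat (M * A * M) = cmat M * cmat A * cmat M"
    using Mc A by (simp add: of_real_hom.mat_hom_mult[of _ n n _ n])
  moreover have "cmat M * cmat M = 1\<^sub>m n"
    using Mc MM by (metis of_real_hom.mat_hom_mult of_real_hom.mat_hom_one)
  ultimately have "similar_mat_wit (cmat (M * A * M)) (cmat A) (cmat M) (cmat M)"
    using Mc A by (intro similar_mat_witI[of _ _ n]) auto
  hence "char_poly (cmat (M * A * M)) = char_poly (cmat A)"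
    by (intro char_poly_similar) (auto simp: similar_mat_def)
  thus ?thesis by (simp add: eigenvalue_mset_def)
qed

subsection \<open>Hopf bifurcation from a dominant pair of gains\<close>

text \<open>\<open>max_gain\<close> sees only the set of these values; a multiset is kept because
  the Hopf condition counts repetitions.\<close>

definition gains :: "complex multiset \<Rightarrow> complex multiset \<Rightarrow> real \<Rightarrow> real \<Rightarrow> real \<Rightarrow> real \<Rightarrow> complex multiset" where
  "gains E1 E2 \<alpha> \<gamma> \<beta> \<delta> =
     (\<Sum>l\<in>#E1. {#of_real \<alpha> + of_real \<gamma> * l + of_real \<beta> * m + of_real \<delta> * (l * m). m \<in># E2#})"

text \<open>The whole spectral input of the Hopf argument: \<open>K\<close> becomes the maximal
  gain, \<open>w\<close> the crossing frequency up to the factor \<open>d / K\<close>, and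
  strictness on \<open>N\<close> keeps all other eigenvalues off the axis.\<close>

definition dominant_pair :: "complex multiset \<Rightarrow> bool" where
  "dominant_pair G \<longleftrightarrow> (\<exists>K w N. K > 0 \<and> w \<noteq> 0 \<and> G = {#Complex K w, Complex K (- w)#} + N
     \<and> (\<forall>x \<in># N. Re x < K))"

text \<open>Exchanging the two graphs exchanges \<gamma> and \<beta>, which reduces the second part
  of the theorem to the same threshold lemma as the first.\<close>

lemma gains_swap: "gains E1 E2 \<alpha> \<gamma> \<beta> \<delta> = gains E2 E1 \<alpha> \<beta> \<gamma> \<delta>"
proof -
  have "gains E1 E2 \<alpha> \<gamma> \<beta> \<delta>
    = (\<Sum>l\<in>#E1. \<Sum>m\<in>#E2. {#of_real \<alpha> + of_real \<gamma> * l + of_real \<beta> * m + of_real \<delta> * (l * m)#})"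
    by (simp add: gains_def)
  also have "\<dots> = (\<Sum>m\<in>#E2. \<Sum>l\<in>#E1. {#of_real \<alpha> + of_real \<gamma> * l + of_real \<beta> * m + of_real \<delta> * (l * m)#})"
    by (rule sum_mset.swap)
  also have "\<dots> = gains E2 E1 \<alpha> \<beta> \<gamma> \<delta>"
    by (simp add: gains_def add_ac mult_ac)
  finally show ?thesis .
qed

lemma leading_pair_pos_mset:
  assumes "leading_pair_pos A" and A: "A \<in> carrier_mat n n"
  obtains m N where "Im m \<noteq> 0" "Re m > 0" "eigenvalue_mset (cmat A) = {#m, cnj m#} + N"
    "\<And>x. x \<in># N \<Longrightarrow> Re x < Re m"
proof -
  let ?E = "eigenvalue_mset (cmat A)" and ?L = "leading (cmat A)"
  have C: "cmat A \<in> carrier_mat n n" using A by simp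
  obtain m where m: "Im m \<noteq> 0" "Re m > 0" and f: "filter_mset ?L ?E = {#m, cnj m#}"
    using assms unfolding leading_pair_pos_def by blast
  have "m \<in># filter_mset ?L ?E" unfolding f by simp
  hence L: "\<And>x. x \<in> spectrum (cmat A) \<Longrightarrow> Re x \<le> Re m" by (simp add: leading_def)
  have E: "?E = {#m, cnj m#} + filter_mset (\<lambda>x. \<not> ?L x) ?E"
    using multiset_partition[of ?E ?L] by (simp only: f)
  have "Re x < Re m" if "x \<in># filter_mset (\<lambda>x. \<not> ?L x) ?E" for x
  proof -
    have "x \<in> spectrum (cmat A)" "\<not> ?L x" using that spectrum_eq_eigenvalue_mset[OF C] by auto
    then obtain y where "y \<in> spectrum (cmat A)" "Re y > Re x" by (auto simp: leading_def not_le)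
    with L show ?thesis by fastforce
  qed
  with m E show ?thesis by (rule that)
qed

text \<open>The sum of the absolute ratios bounds each of them and, unlike a maximum, needs no
  separate treatment of empty \<open>S\<close>.\<close>

lemma linear_domination:
  fixes b c :: "'a \<Rightarrow> real"
  assumes "finite S" and "\<And>x. x \<in> S \<Longrightarrow> c x > 0"
  obtains g0 where "\<And>g x. g > g0 \<Longrightarrow> x \<in> S \<Longrightarrow> b x < g * c x"
proof (rule that)
  fix g x assume g: "g > (\<Sum>x\<in>S. \<bar>b x / c x\<bar>)" and x: "x \<in> S"
  have "b x / c x \<le> \<bar>b x / c x\<bar>" by (rule abs_ge_self)
  also have "\<dots> \<le> (\<Sum>x\<in>S. \<bar>b x / c x\<bar>)" by (rule member_le_sum) (use assms x in auto)
  also note g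
  finally show "b x < g * c x" using assms(2)[OF x] by (simp add: pos_divide_less_eq)
qed

text \<open>On the Perron root the gain has real part
  \<open>\<alpha> + \<gamma> * \<rho> + e * Re x\<close> and imaginary part \<open>e * Im x\<close>
  with \<open>e > 0\<close>, so \<open>m\<close> and its conjugate lead there and stay non-real. Any
  other \<open>l\<close> loses \<open>\<gamma> * (\<rho> - Re l)\<close>, which for large \<gamma>
  outweighs all terms free of \<gamma>.\<close>

lemma gains_dominant_pair:
  assumes \<rho>: "\<rho> > 0" "\<And>x. x \<in># N1 \<Longrightarrow> Re x < \<rho>"
    and m: "Im m \<noteq> 0" "Re m > 0" "\<And>x. x \<in># N2 \<Longrightarrow> Re x < Re m"
    and nonneg: "\<alpha> \<ge> 0" "\<beta> \<ge> 0" "\<delta> \<ge> 0" "\<beta> > 0 \<or> \<delta> > 0"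
  obtains \<gamma>s where "\<And>\<gamma>. \<gamma> > \<gamma>s \<Longrightarrow> \<gamma> \<ge> 0 \<Longrightarrow>
    dominant_pair (gains (add_mset (of_real \<rho>) N1) ({#m, cnj m#} + N2) \<alpha> \<gamma> \<beta> \<delta>)"
proof -
  let ?E2 = "{#m, cnj m#} + N2"
  define e where "e = \<beta> + \<delta> * \<rho>"
  have e: "e > 0" using nonneg \<rho> by (auto simp: e_def intro: add_pos_nonneg add_nonneg_pos)
  \<comment> \<open>The part free of \<gamma> in the difference between the real part of the gain at
    \<open>(l, x)\<close> and \<open>K\<close>.\<close>
  define b where "b = (\<lambda>(l, x). \<beta> * Re x + \<delta> * Re (l * x) - e * Re m)"
  obtain \<gamma>s where \<gamma>s: "\<And>\<gamma> p. \<gamma> > \<gamma>s \<Longrightarrow> p \<in> set_mset N1 \<times> set_mset ?E2 \<Longrightarrow> b p < \<gamma> * (\<rho> - Re (fst p))"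
    by (rule linear_domination[of "set_mset N1 \<times> set_mset ?E2" "\<lambda>p. \<rho> - Re (fst p)" b]) (use \<rho> in auto)
  show ?thesis
  proof (rule that)
    fix \<gamma> assume \<gamma>: "\<gamma> > \<gamma>s" "\<gamma> \<ge> 0"
    define K where "K = \<alpha> + \<gamma> * \<rho> + e * Re m"
    define g where "g l x = of_real \<alpha> + of_real \<gamma> * l + of_real \<beta> * x + of_real \<delta> * (l * x)" for l x :: complex
    have gr: "Re (g (of_real \<rho>) x) = \<alpha> + \<gamma> * \<rho> + e * Re x" "Im (g (of_real \<rho>) x) = e * Im x" for x
      by (simp_all add: g_def e_def algebra_simps)
    define N where "N = image_mset (g (of_real \<rho>)) N2 + (\<Sum>l\<in>#N1. image_mset (g l) ?E2)"
    have "g (of_real \<rho>) m = Complex K (e * Im m)" "g (of_real \<rho>) (cnj m) = Complex K (- (e * Im m))"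
      by (simp_all add: complex_eq_iff gr K_def)
    hence "gains (add_mset (of_real \<rho>) N1) ?E2 \<alpha> \<gamma> \<beta> \<delta> = {#Complex K (e * Im m), Complex K (- (e * Im m))#} + N"
      by (simp add: gains_def N_def flip: g_def)
    moreover have "Re x < K" if "x \<in># N" for x
    proof -
      consider y where "y \<in># N2" "x = g (of_real \<rho>) y" | l y where "l \<in># N1" "y \<in># ?E2" "x = g l y"
        using \<open>x \<in># N\<close> unfolding N_def by auto
      then show ?thesis
      proof cases
        case 1
        then show ?thesis using m(3) e by (simp add: gr K_def)
      next
        case 2
        then have "b (l, y) < \<gamma> * (\<rho> - Re l)" using \<gamma>s[OF \<gamma>(1), of "(l, y)"] by simp
        then show ?thesis unfolding 2 by (simp add: b_def g_def K_def algebra_simps)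
      qed
    qed
    moreover have "K > 0" using nonneg \<gamma> \<rho> e m by (auto simp: K_def intro!: add_nonneg_pos)
    ultimately show "dominant_pair (gains (add_mset (of_real \<rho>) N1) ?E2 \<alpha> \<gamma> \<beta> \<delta>)"
      unfolding dominant_pair_def using e m by (intro exI[of _ K] exI[of _ "e * Im m"] exI[of _ N]) auto
  qed
qed

section \<open>Spectrum of the Jacobian and verification of the Hopf conditions\<close>

definition belief_jacobian ::
  "nat \<Rightarrow> nat \<Rightarrow> real mat \<Rightarrow> real mat \<Rightarrow> real \<Rightarrow> real \<Rightarrow> real \<Rightarrow> real \<Rightarrow> real \<Rightarrow> real \<Rightarrow> real mat" where
  "belief_jacobian Na No Aa Ao d \<alpha> \<gamma> \<beta> \<delta> u =
     (- d + u * \<alpha>) \<cdot>\<^sub>m kronecker (1\<^sub>m Na) (1\<^sub>m No) + (u * \<gamma>) \<cdot>\<^sub>m kronecker Aa (1\<^sub>m No)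
      + (u * \<beta>) \<cdot>\<^sub>m kronecker (1\<^sub>m Na) Ao + (u * \<delta>) \<cdot>\<^sub>m kronecker Aa Ao"

lemma eigenvalue_mset_belief_jacobian:
  assumes A: "Aa \<in> carrier_mat Na Na" and B: "Ao \<in> carrier_mat No No"
  shows "eigenvalue_mset (cmat (belief_jacobian Na No Aa Ao d \<alpha> \<gamma> \<beta> \<delta> u))
    = {#- of_real d + of_real u * g. g \<in># gains (eigenvalue_mset (cmat Aa)) (eigenvalue_mset (cmat Ao)) \<alpha> \<gamma> \<beta> \<delta>#}"
proof -
  have J: "belief_jacobian Na No Aa Ao d \<alpha> \<gamma> \<beta> \<delta> u
      = kron_comb (- d + u * \<alpha>) (u * \<gamma>) (u * \<beta>) (u * \<delta>) Na No Aa Ao"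
    by (simp add: belief_jacobian_def kron_comb_def kronecker_def kron_def)
  have "cmat (kron_comb c0 c1 c2 c3 Na No Aa Ao)
      = kron_comb (of_real c0) (of_real c1) (of_real c2) (of_real c3) Na No (cmat Aa) (cmat Ao)" for c0 c1 c2 c3
  proof (rule eq_matI)
    note c1 = kron_comb_carrier[OF A B] and c2 = kron_comb_carrier[of "cmat Aa" Na "cmat Ao" No]
    let ?K = "kron_comb (of_real c0) (of_real c1) (of_real c2) (of_real c3) Na No (cmat Aa) (cmat Ao)"
    show "dim_row (cmat (kron_comb c0 c1 c2 c3 Na No Aa Ao)) = dim_row ?K"
      "dim_col (cmat (kron_comb c0 c1 c2 c3 Na No Aa Ao)) = dim_col ?K"
      using c1[of c0 c1 c2 c3] c2[of "of_real c0" "of_real c1" "of_real c2" "of_real c3"] A B by auto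
    fix p q assume "p < dim_row ?K" "q < dim_col ?K"
    hence pq: "p < Na * No" "q < Na * No"
      using c2[of "of_real c0" "of_real c1" "of_real c2" "of_real c3"] A B by auto
    show "cmat (kron_comb c0 c1 c2 c3 Na No Aa Ao) $$ (p, q) = ?K $$ (p, q)"
      using pq A B c1[of c0 c1 c2 c3] div_mod_less[OF pq(1)] div_mod_less[OF pq(2)]
      by (simp add: index_kron_comb[of _ Na _ No] Let_def)
  qed
  moreover have "image_mset f (\<Sum>l\<in>#E. G l) = (\<Sum>l\<in>#E. image_mset f (G l))"
    for f :: "complex \<Rightarrow> complex" and G :: "complex \<Rightarrow> complex multiset" and E
    by (induction E) auto
  ultimately show ?thesis
    using A B unfolding J gains_def
    by (simp add: eigenvalue_mset_kron_comb[of _ Na _ No] image_mset.compositionality comp_def algebra_simps)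
qed

lemma belief_field_zero:
  assumes "S1 0 = 0" "S2 0 = 0"
  shows "belief_field Na No Aa Ao S1 S2 d \<alpha> \<gamma> \<beta> \<delta> u (0\<^sub>v (Na * No)) = 0\<^sub>v (Na * No)"
proof (rule eq_vecI)
  fix p assume "p < dim_vec (0\<^sub>v (Na * No) :: real vec)"
  hence p: "p < Na * No" by simp
  note d = div_mod_less[OF p]
  have z: "0\<^sub>v (Na * No) $ (k * No + l) = (0 :: real)" if "k < Na" "l < No" for k l
    using index_less[OF that] by simp
  have s: "(\<Sum>k \<in> {..<Na} - {i}. Aa $$ (i, k) * 0\<^sub>v (Na * No) $ (k * No + l)) = 0" if "l < No" for i l
    using z that by (intro sum.neutral) auto
  show "belief_field Na No Aa Ao S1 S2 d \<alpha> \<gamma> \<beta> \<delta> u (0\<^sub>v (Na * No)) $ p = (0\<^sub>v (Na * No) :: real vec) $ p"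
    using p d unfolding belief_field_def Let_def
    by (simp add: z[OF d] s z assms del: div_mult_mod_eq)
qed (simp add: belief_field_def)

lemma smooth_near_affine: "smooth_near (\<lambda>u. a + u * b) x"
proof -
  define D where "D k = (if k = 0 then (\<lambda>u. a + u * b) else if k = 1 then (\<lambda>_. b) else (\<lambda>_. 0))" for k :: nat
  have "(D k has_real_derivative D (Suc k) t) (at t)" for k t
    by (auto simp: D_def intro!: derivative_eq_intros)
  then show ?thesis unfolding smooth_near_def
    by (intro exI[of _ 1] conjI exI[of _ D]) (auto simp: D_def)
qed

lemma smooth_near_tendsto:
  assumes "smooth_near f x"
  shows "(f \<longlongrightarrow> f x) (nhds x)"
proof -
  obtain D :: "nat \<Rightarrow> real \<Rightarrow> real" and \<epsilon> where "\<epsilon> > 0" "D 0 = f"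
    "\<forall>k t. \<bar>t - x\<bar> < \<epsilon> \<longrightarrow> (D k has_real_derivative D (Suc k) t) (at t)"
    using assms unfolding smooth_near_def by blast
  hence "(f has_real_derivative D (Suc 0) x) (at x)" by (metis abs_zero diff_self)
  then show ?thesis
    using DERIV_isCont isCont_def tendsto_at_iff_tendsto_nhds by blast
qed

lemma hopf_from_dominant_pair:
  assumes adj: "signed_adjacency_mat Na Aa" "signed_adjacency_mat No Ao"
    and sat: "saturating S1" "saturating S2" and d: "d > 0"
    and dom: "dominant_pair (gains (eigenvalue_mset (cmat Aa)) (eigenvalue_mset (cmat Ao)) \<alpha> \<gamma> \<beta> \<delta>)"
  shows "indecision_breaking_hopf Na No Aa Ao S1 S2 d \<alpha> \<gamma> \<beta> \<delta>"
proof -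
  let ?G = "gains (eigenvalue_mset (cmat Aa)) (eigenvalue_mset (cmat Ao)) \<alpha> \<gamma> \<beta> \<delta>"
  have A: "Aa \<in> carrier_mat Na Na" "Ao \<in> carrier_mat No No"
    using adj by (auto simp: signed_adjacency_mat_def)
  obtain K w N where K: "K > 0" "w \<noteq> 0" "?G = {#Complex K w, Complex K (- w)#} + N"
    and N: "\<And>x. x \<in># N \<Longrightarrow> Re x < K"
    using dom unfolding dominant_pair_def by blast
  have sp: "spectrum (cmat Aa) = set_mset (eigenvalue_mset (cmat Aa))"
    "spectrum (cmat Ao) = set_mset (eigenvalue_mset (cmat Ao))"
    using A by (auto intro!: spectrum_eq_eigenvalue_mset)
  have "max_gain Aa Ao \<alpha> \<gamma> \<beta> \<delta> = Max (Re ` set_mset ?G)"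
    unfolding max_gain_def sp by (rule arg_cong[of _ _ Max]) (force simp: gains_def image_iff mult.assoc)
  also have "\<dots> = K"
  proof (rule Max_eqI)
    fix y assume "y \<in> Re ` set_mset ?G"
    then show "y \<le> K" unfolding K(3) using N less_imp_le by auto
  next
    show "K \<in> Re ` set_mset ?G" unfolding K(3) by force
  qed simp
  finally have mg: "max_gain Aa Ao \<alpha> \<gamma> \<beta> \<delta> = K" .
  define us where "us = d / K"
  have us: "us > 0" "us * K = d" using d K by (auto simp: us_def)
  let ?J = "belief_jacobian Na No Aa Ao d \<alpha> \<gamma> \<beta> \<delta>"
  let ?\<omega>0 = "us * w"
  have Jc: "cmat (?J u) \<in> carrier_mat (Na * No) (Na * No)" for u
    using belief_field_jacobian[OF adj sat, of d \<alpha> \<gamma> \<beta> \<delta> u] by (auto simp: has_jacobian_def belief_jacobian_def)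
  have E: "eigenvalue_mset (cmat (?J u)) = {#- of_real d + of_real u * g. g \<in># ?G#}" for u
    by (rule eigenvalue_mset_belief_jacobian[OF A])
  have ev: "eigenvalue (cmat (?J u)) l \<longleftrightarrow> (\<exists>g \<in># ?G. l = - of_real d + of_real u * g)" for u l
    using spectrum_eq_eigenvalue_mset[OF Jc, of u] unfolding E spectrum_def by auto
  have pair: "- of_real d + of_real u * Complex K w = Complex (- d + u * K) (u * w)"
    "- of_real d + of_real u * Complex K (- w) = Complex (- d + u * K) (- (u * w))" for u
    by (simp_all add: complex_eq_iff)
  have axis: "filter_mset (\<lambda>l. Re l = 0) (eigenvalue_mset (cmat (?J us)))
      = {#Complex 0 ?\<omega>0, Complex 0 (- ?\<omega>0)#}"
  proof -
    have rest: "filter_mset (\<lambda>l. Re l = 0) {#- of_real d + of_real us * g. g \<in># N#} = {#}"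
    proof -
      \<comment> \<open>Since \<open>us * K = d\<close>, the left side is \<open>us\<close> times
        \<open>Re g - K\<close>.\<close>
      have "- d + us * Re g < 0" if "g \<in># N" for g
        using mult_strict_left_mono[OF N[OF that] us(1)] us(2) by simp
      then show ?thesis by (intro set_mset_eq_empty_iff[THEN iffD1]) force
    qed
    show ?thesis
      unfolding E K(3) image_mset_union filter_union_mset rest image_mset_add_mset image_mset_empty pair
      using us(2) by simp
  qed
  \<comment> \<open>The eigenvalue line of the dominant gain itself serves as the required smooth
    branch.\<close>
  have branch: "eigenvalue_branch ?J us ?\<omega>0 (\<lambda>u. - d + u * K) (\<lambda>u. u * w)"
  proof -
    have "eigenvalue (cmat (?J u)) (Complex (- d + u * K) (u * w))"
      "eigenvalue (cmat (?J u)) (Complex (- d + u * K) (- (u * w)))" for u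
      unfolding ev K(3) pair[symmetric] by auto
    then show ?thesis
      using us(2) smooth_near_affine[of "- d" K us] smooth_near_affine[of 0 w us]
      unfolding eigenvalue_branch_def by simp
  qed
  have trans: "\<exists>r'. (r has_real_derivative r') (at us) \<and> r' \<noteq> 0"
    if b: "eigenvalue_branch ?J us ?\<omega>0 r \<omega>" for r \<omega>
  proof -
    text \<open>By continuity a branch through the critical eigenvalue stays off all other eigenvalue lines.\<close>
    have "((\<lambda>u. Complex (r u) (\<omega> u)) \<longlongrightarrow> Complex 0 ?\<omega>0) (nhds us)"
      using b smooth_near_tendsto[of r us] smooth_near_tendsto[of \<omega> us]
      by (auto simp: eigenvalue_branch_def intro!: tendsto_Complex)
    then have lim: "((\<lambda>u. Complex (r u) (\<omega> u) - (- of_real d + of_real u * g))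
        \<longlongrightarrow> Complex 0 ?\<omega>0 - (- of_real d + of_real us * g)) (nhds us)" for g
      by (rule tendsto_diff) (intro tendsto_intros filterlim_ident)
    have "\<forall>\<^sub>F u in nhds us. Complex (r u) (\<omega> u) - (- of_real d + of_real u * g) \<noteq> 0"
      if "g \<in> set_mset ?G - {Complex K w}" for g
    proof (rule tendsto_imp_eventually_ne[OF lim])
      \<comment> \<open>At \<open>us > 0\<close> distinct gains give distinct eigenvalues, so only
        the line of \<open>Complex K w\<close> passes through the critical point.\<close>
      have c: "Complex 0 ?\<omega>0 = - of_real d + of_real us * Complex K w" unfolding pair using us(2) by simp
      show "Complex 0 ?\<omega>0 - (- of_real d + of_real us * g) \<noteq> 0"
        unfolding c using that us(1) by auto
    qed
    \<comment> \<open>There are finitely many gains, so one neighbourhood serves for all; there the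
      branch must follow the remaining line.\<close>
    then have "\<forall>\<^sub>F u in nhds us. \<forall>g \<in> set_mset ?G - {Complex K w}.
        Complex (r u) (\<omega> u) - (- of_real d + of_real u * g) \<noteq> 0"
      by (intro eventually_ball_finite) auto
    moreover have "\<forall>\<^sub>F u in nhds us. eigenvalue (cmat (?J u)) (Complex (r u) (\<omega> u))"
      using b by (auto simp: eigenvalue_branch_def elim: eventually_mono)
    ultimately have "\<forall>\<^sub>F u in nhds us. r u = - d + u * K"
    proof eventually_elim
      case (elim u)
      then obtain g where g: "g \<in># ?G" "Complex (r u) (\<omega> u) = - of_real d + of_real u * g" unfolding ev by blast
      with elim(1) have "g = Complex K w" by auto
      with g(2) pair(1)[of u] show ?case by simp
    qed
    moreover have "((\<lambda>u. - d + u * K) has_real_derivative K) (at us)"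
      by (auto intro!: derivative_eq_intros)
    ultimately have "(r has_real_derivative K) (at us)" by (subst DERIV_cong_ev) auto
    with K show ?thesis by auto
  qed
  have "hopf_bifurcation_point (Na * No) (belief_field Na No Aa Ao S1 S2 d \<alpha> \<gamma> \<beta> \<delta>) (0\<^sub>v (Na * No)) us"
    unfolding hopf_bifurcation_point_def
  proof (intro conjI allI exI[of _ ?J] exI[of _ ?\<omega>0])
    show "belief_field Na No Aa Ao S1 S2 d \<alpha> \<gamma> \<beta> \<delta> u (0\<^sub>v (Na * No)) = 0\<^sub>v (Na * No)" for u
      using sat by (intro belief_field_zero) (auto simp: saturating_def)
    show "has_jacobian (Na * No) (belief_field Na No Aa Ao S1 S2 d \<alpha> \<gamma> \<beta> \<delta> u) (0\<^sub>v (Na * No)) (?J u)" for u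
      unfolding belief_jacobian_def by (rule belief_field_jacobian[OF adj sat])
  qed (use us K axis branch trans in auto)
  with K show ?thesis by (simp add: indecision_breaking_hopf_def mg us_def)
qed

lemma switched_eventually_positive_perron:
  assumes "n > 0" "A \<in> carrier_mat n n" "switching_mat n M" "eventually_positive n (M * A * M)"
  obtains \<rho> N where "\<rho> > 0" "eigenvalue_mset (cmat A) = add_mset (complex_of_real \<rho>) N"
    "\<And>m. m \<in># N \<Longrightarrow> Re m < \<rho>"
  by (rule eventually_positive_perron[OF assms(4,1)]) (use that eigenvalue_mset_switching[OF assms(3,2)] in metis)

text \<open>\<open>A1\<close> is the graph with the Perron root and \<gamma> its coefficient,
  whichever of the two networks it is.\<close>

lemma dominant_pair_threshold:
  assumes n: "n1 > 0" and A: "A1 \<in> carrier_mat n1 n1" "A2 \<in> carrier_mat n2 n2"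
    and M: "\<exists>M. switching_mat n1 M \<and> eventually_positive n1 (M * A1 * M)" and L: "leading_pair_pos A2"
    and nonneg: "\<alpha> \<ge> 0" "\<beta> \<ge> 0" "\<delta> \<ge> 0" "\<beta> > 0 \<or> \<delta> > 0"
  shows "\<exists>\<gamma>s. \<forall>\<gamma>. \<gamma> > \<gamma>s \<and> \<gamma> \<ge> 0 \<longrightarrow>
    dominant_pair (gains (eigenvalue_mset (cmat A1)) (eigenvalue_mset (cmat A2)) \<alpha> \<gamma> \<beta> \<delta>)"
proof -
  obtain M where M: "switching_mat n1 M" "eventually_positive n1 (M * A1 * M)" using M by blast
  obtain \<rho> N1 where \<rho>: "\<rho> > 0" "\<And>x. x \<in># N1 \<Longrightarrow> Re x < \<rho>"
    and E1: "eigenvalue_mset (cmat A1) = add_mset (of_real \<rho>) N1"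
    using switched_eventually_positive_perron[OF n A(1) M] by metis
  obtain m N2 where m: "Im m \<noteq> 0" "Re m > 0" "\<And>x. x \<in># N2 \<Longrightarrow> Re x < Re m"
    and E2: "eigenvalue_mset (cmat A2) = {#m, cnj m#} + N2"
    using leading_pair_pos_mset[OF L A(2)] by metis
  show ?thesis unfolding E1 E2 by (rule gains_dominant_pair[OF \<rho> m nonneg]) blast+
qed

theorem propositionV2:
  fixes Na No :: nat and Aa Ao :: "real mat"
  assumes "Na > 0" "No > 0"
    and "signed_adjacency_mat Na Aa" "signed_adjacency_mat No Ao"
  shows
    "((\<exists>M. switching_mat Na M \<and> eventually_positive Na (M * Aa * M)) \<and> leading_pair_pos Ao \<longrightarrow>
      (\<forall>\<alpha> \<beta> \<delta> :: real. \<alpha> \<ge> 0 \<and> \<beta> \<ge> 0 \<and> \<delta> \<ge> 0 \<and> (\<beta> > 0 \<or> \<delta> > 0) \<longrightarrow>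
        (\<exists>\<gamma>s :: real. \<forall>\<gamma>. \<gamma> > \<gamma>s \<and> \<gamma> \<ge> 0 \<longrightarrow>
          (\<forall>(d :: real) S1 S2. d > 0 \<and> saturating S1 \<and> saturating S2 \<longrightarrow>
             indecision_breaking_hopf Na No Aa Ao S1 S2 d \<alpha> \<gamma> \<beta> \<delta>))))
   \<and> ((\<exists>M. switching_mat No M \<and> eventually_positive No (M * Ao * M)) \<and> leading_pair_pos Aa \<longrightarrow>
      (\<forall>\<alpha> \<gamma> \<delta> :: real. \<alpha> \<ge> 0 \<and> \<gamma> \<ge> 0 \<and> \<delta> \<ge> 0 \<and> (\<gamma> > 0 \<or> \<delta> > 0) \<longrightarrow>
        (\<exists>\<beta>s :: real. \<forall>\<beta>. \<beta> > \<beta>s \<and> \<beta> \<ge> 0 \<longrightarrow>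
          (\<forall>(d :: real) S1 S2. d > 0 \<and> saturating S1 \<and> saturating S2 \<longrightarrow>
             indecision_breaking_hopf Na No Aa Ao S1 S2 d \<alpha> \<gamma> \<beta> \<delta>))))"
proof -
  have A: "Aa \<in> carrier_mat Na Na" "Ao \<in> carrier_mat No No"
    using assms by (auto simp: signed_adjacency_mat_def)
  note hopf = hopf_from_dominant_pair[OF assms(3,4)]
  show ?thesis
  proof (intro conjI impI allI; elim conjE)
    fix \<alpha> \<beta> \<delta> :: real
    assume "\<exists>M. switching_mat Na M \<and> eventually_positive Na (M * Aa * M)" "leading_pair_pos Ao"
      "\<alpha> \<ge> 0" "\<beta> \<ge> 0" "\<delta> \<ge> 0" "\<beta> > 0 \<or> \<delta> > 0"
    \<comment> \<open>Dominance of the pair involves neither \<open>d\<close> nor the saturations,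
      so the threshold is uniform in them.\<close>
    from dominant_pair_threshold[OF assms(1) A this]
    show "\<exists>\<gamma>s :: real. \<forall>\<gamma>. \<gamma> > \<gamma>s \<and> \<gamma> \<ge> 0 \<longrightarrow>
          (\<forall>(d :: real) S1 S2. d > 0 \<and> saturating S1 \<and> saturating S2 \<longrightarrow>
             indecision_breaking_hopf Na No Aa Ao S1 S2 d \<alpha> \<gamma> \<beta> \<delta>)"
      using hopf by blast
  next
    fix \<alpha> \<gamma> \<delta> :: real
    assume "\<exists>M. switching_mat No M \<and> eventually_positive No (M * Ao * M)" "leading_pair_pos Aa"
      "\<alpha> \<ge> 0" "\<gamma> \<ge> 0" "\<delta> \<ge> 0" "\<gamma> > 0 \<or> \<delta> > 0"
    \<comment> \<open>With \<open>Ao\<close> in the Perron role, \<beta> takes the place of the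
      large coefficient and \<gamma> that of the fixed one.\<close>
    from dominant_pair_threshold[OF assms(2) A(2,1) this]
    show "\<exists>\<beta>s :: real. \<forall>\<beta>. \<beta> > \<beta>s \<and> \<beta> \<ge> 0 \<longrightarrow>
          (\<forall>(d :: real) S1 S2. d > 0 \<and> saturating S1 \<and> saturating S2 \<longrightarrow>
             indecision_breaking_hopf Na No Aa Ao S1 S2 d \<alpha> \<gamma> \<beta> \<delta>)"
      using hopf unfolding gains_swap[of "eigenvalue_mset (cmat Ao)"] by blast
  qed
qed

end
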